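(* Let $p,q$ be positive integers. There is a bijection $\Phi$ from the set of domino tilings of the grid of $DGG_{p,q}$ onto the set of Hamiltonian paths of $DGG_{p,q}$ such that, for each domino tiling $T$, the path $\Phi(T)$ is the only Hamiltonian path of $DGG_{p,q}$ that bisects no domino of $T$ (i.e. that avoids every domino of $T$).
   Context: For positive integers $p,q$, $DGG_{p,q}$ is the directed graph with vertex set $\{1,\dots,p\}\times\{1,\dots,q\}$ (viewed as a subset of the $xy$-plane) having as arcs, whenever both endpoints are vertices: $(x;y)\to(x+1;y)$ if $y$ is odd; $(x;y)\to(x-1;y)$ if $y$ is even; $(x;y)\to(x;y+1)$ if $x$ is odd; $(x;y)\to(x;y-1)$ if $x$ is even. A Hamiltonian path of $DGG_{p,q}$ is an ordering $v_1\to v_2\to\dots\to v_{pq}$ of all the vertices such that $v_n\to v_{n+1}$ is an arc for each $n\in\{1,\dots,pq-1\}$. Its arcs are the arcs $v_n\to v_{n+1}$. A domino is a (non-degenerate) rectangle whose corners are all vertices of the graph and whose diagonals have length exactly $\sqrt5$ (that is, an axis-parallel $1\times 2$ or $2\times 1$ rectangle with corners in the vertex set). A domino tiling is a set of pairwise nonoverlapping dominoes (disjoint interiors) whose union is the entire grid, i.e. the rectangle with corners $(1;1),(p;1),(p;q),(1;q)$. Such a tiling consists of $(p-1)(q-1)/2$ dominoes. Convention: if $\min\{p,q\}=1$ the rectangle is degenerate, and the empty set of dominoes is counted as its unique domino tiling. A Hamiltonian path avoids a domino (equivalently, does not bisect it) if the shorter symmetry axis of the domino, i.e. the unit segment joining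 the midpoints of its two sides of length $2$, is not an arc of the Hamiltonian path; otherwise it bisects the domino. (The endpoints of this segment are two adjacent vertices, joined by exactly one arc of $DGG_{p,q}$.) *)

theory Defs
  imports "HOL-Analysis.Analysis" "Graph_Theory.Graph_Theory"
begin

section \<open>The directed grid graph\<close>

text \<open>Vertices have integer coordinates, so that \<open>x - 1\<close> is never truncated.\<close>

definition DGG :: "nat \<Rightarrow> nat \<Rightarrow> (int \<times> int) pair_pre_digraph" where
  "DGG p q =
    (let V = {1..int p} \<times> {1..int q} in
     \<lparr> pverts = V,
       parcs = {(u, v). u \<in> V \<and> v \<in> V \<and>
         (case u of (x, y) \<Rightarrow>
            odd y \<and> v = (x + 1, y) \<or>
            even y \<and> v = (x - 1, y) \<or>
            odd x \<and> v = (x, y + 1) \<or>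
            even x \<and> v = (x, y - 1))} \<rparr>)"

text \<open>A Hamiltonian path is given by its sequence of vertices. The library's \<open>vpath\<close> is a
  nonempty vertex walk along arcs without repeated vertices, and \<open>vwalk_arcs\<close> lists the pairs of
  consecutive vertices.\<close>

definition hamiltonian_path :: "'a pair_pre_digraph \<Rightarrow> 'a list \<Rightarrow> bool" where
  "hamiltonian_path G vs \<longleftrightarrow> vpath vs (with_proj G) \<and> set vs = pverts G"


section \<open>Domino tilings of the grid\<close>

definition pt :: "int \<times> int \<Rightarrow> real \<times> real" where
  "pt v = (real_of_int (fst v), real_of_int (snd v))"

text \<open>Dominoes are closed rectangles in the plane. Nondegenerate integer side lengths
  with a diagonal of length \<open>sqrt 5\<close> are 1 and 2 in some order.\<close>

definition domino :: "nat \<Rightarrow> nat \<Rightarrow> (real \<times> real) set \<Rightarrow> bool" where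
  "domino p q D \<longleftrightarrow>
    (\<exists>a b c d. a < c \<and> b < d \<and>
       {(a, b), (c, b), (c, d), (a, d)} \<subseteq> pverts (DGG p q) \<and>
       dist (pt (a, b)) (pt (c, d)) = sqrt 5 \<and>
       D = cbox (pt (a, b)) (pt (c, d)))"

text \<open>If \<open>min p q = 1\<close>, the grid is a segment or a point; by convention its only tiling is empty,
  although the empty union is not the grid.\<close>

definition domino_tiling :: "nat \<Rightarrow> nat \<Rightarrow> (real \<times> real) set set \<Rightarrow> bool" where
  "domino_tiling p q T \<longleftrightarrow>
    (if min p q = 1 then T = {}
     else (\<forall>D\<in>T. domino p q D) \<and>
          pairwise (\<lambda>D E. interior D \<inter> interior E = {}) T \<and>
          \<Union>T = cbox (pt (1, 1)) (pt (int p, int q)))"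

text \<open>\<open>shorter_axis D S\<close> relates a domino to the segment joining the midpoints
  of its two sides of length 2.\<close>

definition shorter_axis :: "(real \<times> real) set \<Rightarrow> (real \<times> real) set \<Rightarrow> bool" where
  "shorter_axis D S \<longleftrightarrow>
    (\<exists>a b.
       D = cbox (a, b) (a + 2, b + 1) \<and> S = closed_segment (a + 1, b) (a + 1, b + 1) \<or>
       D = cbox (a, b) (a + 1, b + 2) \<and> S = closed_segment (a, b + 1) (a + 1, b + 1))"

definition bisects :: "(int \<times> int) list \<Rightarrow> (real \<times> real) set \<Rightarrow> bool" where
  "bisects vs D \<longleftrightarrow>
    (\<exists>(u, v) \<in> set (vwalk_arcs vs). shorter_axis D (closed_segment (pt u) (pt v)))"

end

theory Submission
  imports Defs
begin

text \<open>Colour the unit cells of the lattice like a chessboard. Every arc is a side of exactly one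
  black cell, and both arcs leaving a vertex belong to the same black cell. In a Hamiltonian path,
  the two arcs of a black cell that are used are either both horizontal or both vertical, so the
  path amounts to a choice of a direction at every black cell. A tiling by dominoes matches every
  black cell with a white one, and the path avoids the tiling iff the arcs used at each black cell
  are parallel to the long sides of its domino.

  Given a tiling, the choice could produce cycles besides the path. Send a white cell to its
  partner and a black cell to the neighbour opposite to its partner; this never crosses a used
  arc. Hence the region enclosed by a cycle of arcs is closed under this map on cells and contains
  a cycle of cells, which in turn encloses a smaller set of vertices closed under the steps. This
  infinite descent excludes both kinds of cycles.

  Conversely, for a Hamiltonian path the unused sides join the cells and the outside in a tree in
  which each black cell has degree two. Matching each white cell with its parent gives the tiling.
  Two tilings avoided by the same path agree because the cells on which they differ would be
  closed under the map on cells.\<close>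

section \<open>Steps on the integer lattice\<close>

text \<open>Cells are represented by their lower left corners. \<open>out_cell u\<close> and \<open>in_cell u\<close> are the cells
  that contain the two arcs out of \<open>u\<close> and into \<open>u\<close>, respectively. For adjacent cells, \<open>sep c d\<close>
  consists of the end points of the common side, and \<open>passable \<sigma> c d\<close> says that no step traverses
  this side.\<close>

definition hstep :: "int \<times> int \<Rightarrow> int \<times> int" where
  "hstep u = (case u of (x, y) \<Rightarrow> (if odd y then x + 1 else x - 1, y))"

definition vstep :: "int \<times> int \<Rightarrow> int \<times> int" where
  "vstep u = (case u of (x, y) \<Rightarrow> (x, if odd x then y + 1 else y - 1))"

definition black :: "int \<times> int \<Rightarrow> bool" where
  "black c \<longleftrightarrow> even (fst c + snd c)"

definition out_cell :: "int \<times> int \<Rightarrow> int \<times> int" where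
  "out_cell u = (case u of (x, y) \<Rightarrow> (if odd y then x else x - 1, if odd x then y else y - 1))"

definition in_cell :: "int \<times> int \<Rightarrow> int \<times> int" where
  "in_cell u = (case u of (x, y) \<Rightarrow> (if odd y then x - 1 else x, if odd x then y - 1 else y))"

definition step :: "(int \<times> int \<Rightarrow> bool) \<Rightarrow> int \<times> int \<Rightarrow> int \<times> int" where
  "step \<sigma> u = (if \<sigma> (out_cell u) then hstep u else vstep u)"

lemmas step_defs = hstep_def vstep_def out_cell_def in_cell_def black_def

definition adjacent :: "int \<times> int \<Rightarrow> int \<times> int \<Rightarrow> bool" where
  "adjacent c d \<longleftrightarrow> \<bar>fst c - fst d\<bar> + \<bar>snd c - snd d\<bar> = 1"

definition sep :: "int \<times> int \<Rightarrow> int \<times> int \<Rightarrow> (int \<times> int) set" where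
  "sep c d = {(max (fst c) (fst d), max (snd c) (snd d)),
              (min (fst c) (fst d) + 1, min (snd c) (snd d) + 1)}"

definition passable :: "(int \<times> int \<Rightarrow> bool) \<Rightarrow> int \<times> int \<Rightarrow> int \<times> int \<Rightarrow> bool" where
  "passable \<sigma> c d \<longleftrightarrow> (\<sigma> (if black c then c else d) \<longleftrightarrow> snd c = snd d)"

lemma adjacent_cases:
  assumes "adjacent c d"
  obtains x y where "c = (x, y)" "d = (x + 1, y)"
    | x y where "c = (x + 1, y)" "d = (x, y)"
    | x y where "c = (x, y)" "d = (x, y + 1)"
    | x y where "c = (x, y + 1)" "d = (x, y)"
proof -
  obtain x y x' y' where cd: "c = (x, y)" "d = (x', y')" by fastforce
  have "x' = x + 1 \<and> y' = y \<or> x = x' + 1 \<and> y' = y \<or> x' = x \<and> y' = y + 1 \<or> x' = x \<and> y = y' + 1"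
    using assms by (auto simp: cd adjacent_def)
  then show thesis using that by (auto simp: cd)
qed

lemma adjacent_sym: "adjacent c d \<longleftrightarrow> adjacent d c"
  by (auto simp: adjacent_def)

lemma black_adjacent: "adjacent c d \<Longrightarrow> black d \<longleftrightarrow> \<not> black c"
  by (erule adjacent_cases) (auto simp: black_def)

lemma passable_sym: "adjacent c d \<Longrightarrow> passable \<sigma> c d \<longleftrightarrow> passable \<sigma> d c"
  using black_adjacent by (auto simp: passable_def)

lemma out_cell_eq_in_cell:
  "out_cell u = in_cell (hstep u)" "out_cell u = in_cell (vstep u)"
  by (auto simp: step_defs split: prod.splits)

lemma inj_hstep: "hstep u = hstep w \<longleftrightarrow> u = w"
  by (auto simp: step_defs split: prod.splits if_splits)

lemma inj_vstep: "vstep u = vstep w \<longleftrightarrow> u = w"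
  by (auto simp: step_defs split: prod.splits if_splits)

text \<open>Two opposite corners of a black cell are the tails of its four sides, the other two are
  the heads. So the horizontal side from one tail meets the vertical side from the other.\<close>

lemma hstep_opposite_corner:
  "out_cell u = out_cell w \<Longrightarrow> u \<noteq> w \<Longrightarrow> hstep w = vstep u"
  by (auto simp: step_defs split: prod.splits if_splits; presburger)

text \<open>Steps with the same end share their black cell, since \<open>out_cell\<close> is
  recovered as the \<open>in_cell\<close> of the end. There they have the same direction, and each
  direction is injective.\<close>

lemma inj_step: "step \<sigma> u = step \<sigma> w \<longleftrightarrow> u = w"
proof
  assume eq: "step \<sigma> u = step \<sigma> w"
  have "out_cell v = in_cell (step \<sigma> v)" for v
    by (simp add: step_def flip: out_cell_eq_in_cell)
  with eq have "out_cell u = out_cell w" by metis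
  with eq show "u = w" by (auto simp: step_def inj_hstep inj_vstep split: if_splits)
qed simp

lemma adjacent_step: "adjacent u (step \<sigma> u)"
  by (auto simp: step_def adjacent_def step_defs split: prod.splits)

lemma step_step_neq: "step \<sigma> (step \<sigma> u) \<noteq> u"
  by (auto simp: step_def step_defs split: prod.splits if_splits)

text \<open>Together with \<open>sep_eq_step\<close>, this identifies the impassable sides with
  those traversed by a step.\<close>

lemma passable_imp_sep_neq:
  assumes "adjacent c d" "passable \<sigma> c d"
  shows "sep c d \<noteq> {u, step \<sigma> u}"
proof
  assume eq: "sep c d = {u, step \<sigma> u}"
  obtain a b where u: "u = (a, b)" by fastforce
  show False
    using assms eq
    by (elim adjacent_cases; cases "odd a"; cases "odd b"; cases "\<sigma> (out_cell u)")
       (auto simp: u sep_def step_def step_defs passable_def doubleton_eq_iff split: if_splits)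
qed

lemma sep_eq_step:
  assumes "adjacent c d" "\<not> passable \<sigma> c d"
  obtains u where "sep c d = {u, step \<sigma> u}"
proof -
  have "sep c d = {u, step \<sigma> u} \<or> sep c d = {w, step \<sigma> w}"
    if "u = (max (fst c) (fst d), max (snd c) (snd d))"
       "w = (min (fst c) (fst d) + 1, min (snd c) (snd d) + 1)" for u w
    using assms
    by (elim adjacent_cases)
       (auto simp: that sep_def step_def step_defs passable_def doubleton_eq_iff)
  then show thesis using that by metis
qed

text \<open>Cells are the vertices of a dual lattice, whose cell \<open>(x - 1, y - 1)\<close>
  surrounds the vertex \<open>(x, y)\<close>. This lets \<open>enclosed_region\<close> be applied to
  cycles of cells.\<close>

lemma sep_dual:
  assumes "adjacent (x, y) (x', y')" "sep (x - 1, y - 1) (x' - 1, y' - 1) = {c, d}"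
  shows "sep c d = {(x, y), (x', y')}"
  using assms by (elim adjacent_cases) (auto simp: sep_def doubleton_eq_iff)

section \<open>Regions enclosed by cycles\<close>

text \<open>The region is the support of the winding number \<open>W\<close> around the cells, computed by counting
  signed crossings to the left of a cell.\<close>

lemma enclosed_region:
  fixes f :: "int \<times> int \<Rightarrow> int \<times> int"
  assumes S: "S \<noteq> {}" "f ` S = S" "S \<subseteq> {a..b} \<times> {c..d}"
    and adj: "\<And>u. u \<in> S \<Longrightarrow> adjacent u (f u)"
    and no_2cycle: "\<And>u. u \<in> S \<Longrightarrow> f (f u) \<noteq> u"
  obtains R where "R \<noteq> {}" "R \<subseteq> {a..<b} \<times> {c..<d}"
    "\<And>e e'. e \<in> R \<Longrightarrow> e' \<notin> R \<Longrightarrow> adjacent e e' \<Longrightarrow> \<exists>u\<in>S. sep e e' = {u, f u}"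
proof -
  \<comment> \<open>\<open>F\<close> is the signed flow of the cycles along an edge. Without
    2-cycles its two terms cannot cancel.\<close>
  define F :: "int \<times> int \<Rightarrow> int \<times> int \<Rightarrow> int" where
    "F u w = of_bool (u \<in> S \<and> f u = w) - of_bool (w \<in> S \<and> f w = u)" for u w
  have fin: "finite S"
    using S(3) by (rule finite_subset) auto
  have inj: "inj_on f S"
    using fin S(2) by (simp add: eq_card_imp_inj_on)
  have F_nz: "F u w \<noteq> 0 \<Longrightarrow> u \<in> S \<and> w \<in> S \<and> (f u = w \<or> f w = u)" for u w
    using S(2) by (auto simp: F_def of_bool_def split: if_splits)
  have F_sym: "F w u = - F u w" for u w
    by (simp add: F_def)
  have F_step: "F u (f u) \<noteq> 0" if "u \<in> S" for u
    using that no_2cycle by (auto simp: F_def)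
  define h v where "h x y = F (x, y) (x + 1, y)" and "v x y = F (x, y) (x, y + 1)" for x y
  have out: "of_bool (u \<in> S) = (of_bool (u \<in> S \<and> f u = (x + 1, y)) + of_bool (u \<in> S \<and> f u = (x - 1, y))
      + of_bool (u \<in> S \<and> f u = (x, y + 1)) + of_bool (u \<in> S \<and> f u = (x, y - 1)) :: int)"
    if "u = (x, y)" for u x y
  proof (cases "u \<in> S")
    case True
    with adj[OF True] show ?thesis
      by (elim adjacent_cases) (auto simp: that)
  qed simp
  have "in": "of_bool (u \<in> S) = (of_bool ((x + 1, y) \<in> S \<and> f (x + 1, y) = u) + of_bool ((x - 1, y) \<in> S \<and> f (x - 1, y) = u)
      + of_bool ((x, y + 1) \<in> S \<and> f (x, y + 1) = u) + of_bool ((x, y - 1) \<in> S \<and> f (x, y - 1) = u) :: int)"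
    if "u = (x, y)" for u x y
  proof (cases "u \<in> S")
    case True
    then obtain w where w: "w \<in> S" "f w = u" using S(2) by (metis imageE)
    have uniq: "z \<in> S \<and> f z = u \<longleftrightarrow> z = w" for z
      using w inj_onD[OF inj] by metis
    have "adjacent w (x, y)" using adj[OF w(1)] w(2) that by simp
    then have "(1 :: int) = of_bool ((x + 1, y) = w) + of_bool ((x - 1, y) = w)
        + of_bool ((x, y + 1) = w) + of_bool ((x, y - 1) = w)"
      by (elim adjacent_cases) auto
    then show ?thesis
      unfolding uniq using True by simp
  next
    case False
    then have "\<not> (z \<in> S \<and> f z = u)" for z using S(2) by (metis imageI)
    then show ?thesis using False by simp
  qed
  \<comment> \<open>Flow is conserved: a vertex of \<open>S\<close> has one incoming and one
    outgoing arc of the cycles, any other vertex has none.\<close>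
  have flow: "h x y - h (x - 1) y + v x y - v x (y - 1) = 0" for x y
    using out[OF refl, of x y] "in"[OF refl, of x y] by (simp add: h_def v_def F_def)
  have v_zero: "v x y = 0" if "x < a \<or> y < c \<or> d \<le> y" for x y
    using F_nz[of "(x, y)" "(x, y + 1)"] S(3) that by (fastforce simp: v_def)
  have h_zero: "h x y = 0" if "x < a \<or> b \<le> x" for x y
    using F_nz[of "(x, y)" "(x + 1, y)"] S(3) that by (fastforce simp: h_def)
  define W where "W x y = - (\<Sum>t\<in>{a..x}. v t y)" for x y
  have Wx: "W x y - W (x - 1) y = - v x y" for x y
  proof (cases "x < a")
    case False
    then have "{a..x} = insert x {a..x - 1}" by auto
    then show ?thesis by (simp add: W_def)
  qed (simp add: W_def v_zero)
  \<comment> \<open>Row sums give only the horizontal differences of \<open>W\<close>. Conservation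
    of flow carries the vertical ones from column to column, starting left of the box.\<close>
  have Wy_aux: "W x y - W x (y - 1) = h x y" if "a - 1 \<le> x" for x y
    using that
  proof (induction x rule: int_ge_induct)
    case base
    then show ?case by (simp add: W_def h_zero)
  next
    case (step x)
    then show ?case
      using Wx[of "x + 1" y] Wx[of "x + 1" "y - 1"] flow[of "x + 1" y] by simp
  qed
  have Wy: "W x y - W x (y - 1) = h x y" for x y
    using Wy_aux[of x y] by (cases "x < a") (auto simp: W_def h_zero)
  have W_x0: "W x y = 0" if "x < a" for x y
    using that by (simp add: W_def)
  have W_y0: "W x y = 0" if "y < c \<or> d \<le> y" for x y
    using that by (simp add: W_def v_zero)
  \<comment> \<open>From column \<open>b\<close> on there is no horizontal flow, so \<open>W\<close>
    is constant along each column, and it vanishes below the box.\<close>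
  have W_x1: "W x y = 0" if "b \<le> x" for x y
  proof (cases "c - 1 \<le> y")
    case True
    then show ?thesis
    proof (induction y rule: int_ge_induct)
      case (step y)
      then show ?case using Wy[of x "y + 1"] that by (simp add: h_zero)
    qed (simp add: W_y0)
  qed (simp add: W_y0)
  define R where "R = {(x, y). W x y \<noteq> 0}"
  have R_bounds: "R \<subseteq> {a..<b} \<times> {c..<d}"
  proof (rule subrelI)
    fix x y assume "(x, y) \<in> R"
    then have "W x y \<noteq> 0" by (simp add: R_def)
    then have "\<not> x < a" "\<not> b \<le> x" "\<not> (y < c \<or> d \<le> y)"
      using W_x0 W_x1 W_y0 by metis+
    then show "(x, y) \<in> {a..<b} \<times> {c..<d}" by simp
  qed
  have cross: "\<exists>u\<in>S. sep e e' = {u, f u}" if "e \<in> R" "e' \<notin> R" "adjacent e e'" for e e'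
  proof -
    have edge: ?thesis if "F u w \<noteq> 0" "sep e e' = {u, w}" for u w
      using F_nz[OF that(1)] that(2) by (auto simp: insert_commute)
    show ?thesis
      using \<open>adjacent e e'\<close>
    proof (cases rule: adjacent_cases)
      case (1 x y)
      then show ?thesis using that(1,2) Wx[of "x + 1" y]
        by (intro edge[of "(x + 1, y)" "(x + 1, y + 1)"]) (auto simp: R_def v_def sep_def)
    next
      case (2 x y)
      then show ?thesis using that(1,2) Wx[of "x + 1" y]
        by (intro edge[of "(x + 1, y)" "(x + 1, y + 1)"]) (auto simp: R_def v_def sep_def)
    next
      case (3 x y)
      then show ?thesis using that(1,2) Wy[of x "y + 1"]
        by (intro edge[of "(x, y + 1)" "(x + 1, y + 1)"]) (auto simp: R_def h_def sep_def)
    next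
      case (4 x y)
      then show ?thesis using that(1,2) Wy[of x "y + 1"]
        by (intro edge[of "(x, y + 1)" "(x + 1, y + 1)"]) (auto simp: R_def h_def sep_def)
    qed
  qed
  \<comment> \<open>If \<open>W\<close> vanished everywhere, so would its differences, which are the
    flows.\<close>
  have "R \<noteq> {}"
  proof
    assume "R = {}"
    then have "W x y = 0" for x y by (auto simp: R_def)
    then have "h x y = 0" "v x y = 0" for x y
      using Wx[of x y] Wy[of x y] by auto
    then have "F (x, y) (x + 1, y) = 0" "F (x, y) (x, y + 1) = 0"
      "F (x + 1, y) (x, y) = 0" "F (x, y + 1) (x, y) = 0" for x y
      by (simp_all add: h_def v_def F_sym[where u = "(x, y)"])
    then have "F u w = 0" if "adjacent u w" for u w
      using that by (elim adjacent_cases) auto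
    then show False using F_step adj S(1) by (metis ex_in_conv)
  qed
  then show thesis by (rule that[OF _ R_bounds cross])
qed

text \<open>In a nonempty invariant subset of least cardinality the image is again invariant, hence
  not smaller.\<close>

lemma closed_set_contains_cycles:
  assumes "finite A" "A \<noteq> {}" "f ` A \<subseteq> A"
  obtains S where "S \<noteq> {}" "S \<subseteq> A" "f ` S = S"
proof -
  let ?P = "\<lambda>S. S \<noteq> {} \<and> S \<subseteq> A \<and> f ` S \<subseteq> S"
  obtain S where S: "?P S" and min: "\<And>S'. ?P S' \<Longrightarrow> card S \<le> card S'"
  proof -
    have "?P A" using assms by simp
    from ex_has_least_nat[of ?P A card, OF this] show thesis using that by blast
  qed
  have "finite S" using S assms(1) finite_subset by blast
  moreover have "card S \<le> card (f ` S)"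
    using S by (intro min) auto
  ultimately have "f ` S = S" using S by (intro card_seteq) auto
  then show thesis using S that by blast
qed

section \<open>Matchings of cells and the induced map on cells\<close>

definition cells :: "nat \<Rightarrow> nat \<Rightarrow> (int \<times> int) set" where
  "cells p q = {1..<int p} \<times> {1..<int q}"

definition matching :: "(int \<times> int) set \<Rightarrow> (int \<times> int \<Rightarrow> int \<times> int) \<Rightarrow> bool" where
  "matching C m \<longleftrightarrow> (\<forall>c\<in>C. m c \<in> C \<and> adjacent c (m c) \<and> m (m c) = c)"

text \<open>At a black cell the value is the mirror image of the partner, which may lie outside the
  set of matched cells.\<close>

definition across :: "(int \<times> int \<Rightarrow> int \<times> int) \<Rightarrow> int \<times> int \<Rightarrow> int \<times> int" where
  "across m c = (if black c then (2 * fst c - fst (m c), 2 * snd c - snd (m c)) else m c)"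

lemma adjacent_across:
  "matching C m \<Longrightarrow> c \<in> C \<Longrightarrow> adjacent c (across m c)"
  by (auto simp: matching_def across_def adjacent_def)

text \<open>A black cell moves to a white cell that is not its partner and hence does not return to
  it. A white cell moves to its black partner and then straight on.\<close>

lemma across_across_neq:
  assumes "matching C m" "c \<in> C" "across m c \<in> C"
  shows "across m (across m c) \<noteq> c"
proof (cases "black c")
  case True
  have adj: "adjacent c (m c)" and "m (m c) = c" using assms by (auto simp: matching_def)
  have "\<not> black (across m c)"
    using True adjacent_across[OF assms(1,2)] black_adjacent by blast
  then have "across m (across m c) = m (across m c)" by (simp add: across_def)
  moreover have "m (across m c) \<noteq> c"
  proof
    assume "m (across m c) = c"
    then have "across m c = m c" using assms by (metis matching_def)
    then show False using True adj by (auto simp: across_def adjacent_def prod_eq_iff)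
  qed
  ultimately show ?thesis by simp
next
  case False
  have adj: "adjacent c (m c)" and mm: "m (m c) = c" using assms by (auto simp: matching_def)
  have "black (m c)" using False adj black_adjacent by blast
  then have "across m (across m c) = (2 * fst (m c) - fst c, 2 * snd (m c) - snd c)"
    using False mm by (simp add: across_def)
  then show ?thesis using adj by (auto simp: adjacent_def prod_eq_iff)
qed

lemma passable_across:
  assumes "matching C m" "c \<in> C" "passable \<sigma> c (m c)"
  shows "passable \<sigma> c (across m c)"
  using assms by (auto simp: across_def passable_def)

text \<open>Infinite descent on the number of columns: a closed set of vertices in \<open>b\<close>
  columns encloses a closed set of cells in \<open>b - 1\<close> columns, which yields a closed set
  of vertices in \<open>b - 1\<close> columns.\<close>

lemma no_closed_sets:
  fixes p q :: nat
  assumes m: "matching (cells p q) m"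
    and pass: "\<And>c. c \<in> cells p q \<Longrightarrow> passable \<sigma> c (m c)"
  shows "S \<noteq> {} \<Longrightarrow> S \<subseteq> {1..int p} \<times> {1..int q} \<Longrightarrow> step \<sigma> ` S \<subseteq> S \<Longrightarrow> False"
    and "R \<noteq> {} \<Longrightarrow> R \<subseteq> cells p q \<Longrightarrow> across m ` R \<subseteq> R \<Longrightarrow> False"
proof -
  have to_cells: "\<exists>R. R \<noteq> {} \<and> R \<subseteq> {1..<b} \<times> {1..<int q} \<and> across m ` R \<subseteq> R"
    if A: "A \<noteq> {}" "A \<subseteq> {1..b} \<times> {1..int q}" "step \<sigma> ` A \<subseteq> A" and "b \<le> int p" for A b
  proof -
    have "finite A" using A(2) by (rule finite_subset) auto
    then obtain S where S: "S \<noteq> {}" "S \<subseteq> A" "step \<sigma> ` S = S"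
      using closed_set_contains_cycles[OF _ A(1,3)] by metis
    have S_sub: "S \<subseteq> {1..b} \<times> {1..int q}" using S(2) A(2) by blast
    obtain R where R: "R \<noteq> {}" "R \<subseteq> {1..<b} \<times> {1..<int q}"
      "\<And>e e'. e \<in> R \<Longrightarrow> e' \<notin> R \<Longrightarrow> adjacent e e' \<Longrightarrow> \<exists>u\<in>S. sep e e' = {u, step \<sigma> u}"
      using enclosed_region[OF S(1,3) S_sub adjacent_step step_step_neq] by metis
    \<comment> \<open>Leaving \<open>R\<close> would cross a side traversed by a step, but
      \<open>across\<close> crosses only passable sides.\<close>
    have "across m c \<in> R" if cR: "c \<in> R" for c
    proof (rule ccontr)
      assume "across m c \<notin> R"
      have c: "c \<in> cells p q" using R(2) cR \<open>b \<le> int p\<close> by (auto simp: cells_def)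
      obtain u where "sep c (across m c) = {u, step \<sigma> u}"
        using R(3)[OF cR \<open>across m c \<notin> R\<close>] adjacent_across[OF m c] by blast
      then show False
        using passable_imp_sep_neq[OF adjacent_across[OF m c]] passable_across[OF m c pass[OF c]]
        by blast
    qed
    then show ?thesis using R(1,2) by blast
  qed
  have to_vertices: "\<exists>S. S \<noteq> {} \<and> S \<subseteq> {1..b} \<times> {1..int q} \<and> step \<sigma> ` S \<subseteq> S"
    if A: "A \<noteq> {}" "A \<subseteq> {1..b} \<times> {1..<int q}" "across m ` A \<subseteq> A" and "b < int p" for A b
  proof -
    have "finite A" using A(2) by (rule finite_subset) auto
    then obtain S where S: "S \<noteq> {}" "S \<subseteq> A" "across m ` S = S"
      using closed_set_contains_cycles[OF _ A(1,3)] by metis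
    have S_sub: "S \<subseteq> {1..b} \<times> {1..int q - 1}" using S(2) A(2) by auto
    have SC: "S \<subseteq> cells p q" using S_sub that(4) by (auto simp: cells_def)
    have unit: "adjacent c (across m c)" if "c \<in> S" for c
      using adjacent_across[OF m] SC that by blast
    have ne: "across m (across m c) \<noteq> c" if "c \<in> S" for c
      using across_across_neq[OF m] SC S(3) that by blast
    obtain R where R: "R \<noteq> {}" "R \<subseteq> {1..<b} \<times> {1..<int q - 1}"
      "\<And>e e'. e \<in> R \<Longrightarrow> e' \<notin> R \<Longrightarrow> adjacent e e' \<Longrightarrow> \<exists>c\<in>S. sep e e' = {c, across m c}"
      using enclosed_region[OF S(1,3) S_sub unit ne] by metis
    \<comment> \<open>\<open>R\<close> lives on the dual lattice; \<open>(x, y)\<close> there is the vertex \<open>(x + 1, y + 1)\<close> of the grid.\<close>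
    define T where "T = {(x, y). (x - 1, y - 1) \<in> R}"
    have "step \<sigma> u \<in> T" if uT: "u \<in> T" for u
    proof (rule ccontr)
      assume nT: "step \<sigma> u \<notin> T"
      obtain x y x' y' where xy: "u = (x, y)" "step \<sigma> u = (x', y')" by fastforce
      have adj: "adjacent (x, y) (x', y')" using adjacent_step xy by metis
      then have "adjacent (x - 1, y - 1) (x' - 1, y' - 1)" by (simp add: adjacent_def)
      moreover have "(x - 1, y - 1) \<in> R" "(x' - 1, y' - 1) \<notin> R"
        using uT nT xy by (auto simp: T_def)
      ultimately obtain c where c: "c \<in> S" "sep (x - 1, y - 1) (x' - 1, y' - 1) = {c, across m c}"
        using R(3) by blast
      have "sep c (across m c) = {u, step \<sigma> u}"
        using sep_dual[OF adj c(2)] xy by simp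
      then show False
        using passable_imp_sep_neq[OF unit[OF c(1)]] passable_across[OF m _ pass] c(1) SC by blast
    qed
    moreover have "T \<subseteq> {1..b} \<times> {1..int q}" using R(2) by (force simp: T_def)
    moreover have "T \<noteq> {}"
    proof -
      obtain x y where "(x, y) \<in> R" using R(1) by auto
      then have "(x + 1, y + 1) \<in> T" by (simp add: T_def)
      then show ?thesis by blast
    qed
    ultimately show ?thesis by blast
  qed
  have vertices: False if "S \<noteq> {}" "S \<subseteq> {1..int n} \<times> {1..int q}" "step \<sigma> ` S \<subseteq> S" "n \<le> p" for S n
    using that
  proof (induction n arbitrary: S)
    case (Suc n)
    obtain R where R: "R \<noteq> {}" "R \<subseteq> {1..<int (Suc n)} \<times> {1..<int q}" "across m ` R \<subseteq> R"
      using to_cells[OF Suc.prems(1-3)] Suc.prems(4) by auto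
    have "R \<subseteq> {1..int n} \<times> {1..<int q}" using R(2) by auto
    then show False using to_vertices[OF R(1) _ R(3)] Suc.IH Suc.prems(4)
      by (metis Suc_leD Suc_le_lessD of_nat_less_iff)
  qed auto
  show "S \<noteq> {} \<Longrightarrow> S \<subseteq> {1..int p} \<times> {1..int q} \<Longrightarrow> step \<sigma> ` S \<subseteq> S \<Longrightarrow> False"
    using vertices by blast
  show False if R: "R \<noteq> {}" "R \<subseteq> cells p q" "across m ` R \<subseteq> R"
  proof -
    have "0 < p" using R(1,2) by (auto simp: cells_def)
    have sub: "R \<subseteq> {1..int p - 1} \<times> {1..<int q}" using R(2) by (auto simp: cells_def)
    have pred_less: "int p - 1 < int p" by simp
    obtain S where S: "S \<noteq> {}" "S \<subseteq> {1..int p - 1} \<times> {1..int q}" "step \<sigma> ` S \<subseteq> S"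
      using to_vertices[OF R(1) sub R(3), OF pred_less] by blast
    have "int (p - 1) = int p - 1" using \<open>0 < p\<close> by simp
    then show False using vertices[OF S(1), of "p - 1"] S(2,3) by simp
  qed
qed

section \<open>Hamiltonian paths and choices at the black cells\<close>

abbreviation grid :: "nat \<Rightarrow> nat \<Rightarrow> (int \<times> int) set" where
  "grid p q \<equiv> {1..int p} \<times> {1..int q}"

text \<open>Outside the grid the choice is forced: a step that starts at a border vertex must not leave
  the grid.\<close>

definition extend :: "nat \<Rightarrow> nat \<Rightarrow> (int \<times> int \<Rightarrow> bool) \<Rightarrow> int \<times> int \<Rightarrow> bool" where
  "extend p q \<tau> c \<longleftrightarrow> (if c \<in> cells p q then \<tau> c else 1 \<le> fst c \<and> fst c < int p)"

definition follows :: "(int \<times> int \<Rightarrow> bool) \<Rightarrow> (int \<times> int) list \<Rightarrow> bool" where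
  "follows \<sigma> vs \<longleftrightarrow> (\<forall>i. Suc i < length vs \<longrightarrow> vs ! Suc i = step \<sigma> (vs ! i))"

lemma vwalk_arcs_zip: "vwalk_arcs vs = zip vs (tl vs)"
  by (induction vs rule: vwalk_arcs.induct) auto

lemma set_vwalk_arcs: "set (vwalk_arcs vs) = {(vs ! i, vs ! Suc i) | i. Suc i < length vs}"
  by (auto simp: vwalk_arcs_zip set_zip nth_tl less_diff_conv)

lemma hamiltonian_path_iff:
  "hamiltonian_path (DGG p q) vs \<longleftrightarrow> vs \<noteq> [] \<and> distinct vs \<and> set vs = grid p q \<and>
     (\<forall>i. Suc i < length vs \<longrightarrow> vs ! Suc i = hstep (vs ! i) \<or> vs ! Suc i = vstep (vs ! i))"
  (is "?l \<longleftrightarrow> ?r")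
proof -
  have verts: "pverts (DGG p q) = grid p q"
    by (simp add: DGG_def Let_def)
  have arcs: "(u, v) \<in> parcs (DGG p q) \<longleftrightarrow> u \<in> grid p q \<and> v \<in> grid p q \<and> (v = hstep u \<or> v = vstep u)"
    for u v
    by (cases u; cases "odd (fst u)"; cases "odd (snd u)")
       (simp_all add: DGG_def Let_def hstep_def vstep_def)
  have "?l \<longleftrightarrow> vs \<noteq> [] \<and> distinct vs \<and> set vs = grid p q \<and> set (vwalk_arcs vs) \<subseteq> parcs (DGG p q)"
    by (auto simp: hamiltonian_path_def vpath_def vwalk_def verts)
  also have "\<dots> \<longleftrightarrow> ?r"
  proof (cases "set vs = grid p q")
    case True
    then have "vs ! i \<in> grid p q" if "i < length vs" for i
      using that nth_mem by blast
    then have "set (vwalk_arcs vs) \<subseteq> parcs (DGG p q) \<longleftrightarrow>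
        (\<forall>i. Suc i < length vs \<longrightarrow> vs ! Suc i = hstep (vs ! i) \<or> vs ! Suc i = vstep (vs ! i))"
      unfolding set_vwalk_arcs using arcs Suc_lessD by blast
    then show ?thesis by simp
  qed simp
  finally show ?thesis .
qed

section \<open>Entrance and exit of the grid\<close>

lemma step_neq_source: "u \<in> grid p q \<Longrightarrow> step \<sigma> u \<noteq> (1, 1)"
  by (auto simp: step_def step_defs split: if_splits)

lemma hstep_in_grid_iff:
  "u \<in> grid p q \<Longrightarrow> hstep u \<in> grid p q \<longleftrightarrow> 1 \<le> fst (out_cell u) \<and> fst (out_cell u) < int p"
  by (auto simp: step_defs)

lemma vstep_in_grid_iff:
  "u \<in> grid p q \<Longrightarrow> vstep u \<in> grid p q \<longleftrightarrow> 1 \<le> snd (out_cell u) \<and> snd (out_cell u) < int q"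
  by (auto simp: step_defs)

lemma mem_cells_iff: "c \<in> cells p q \<longleftrightarrow> 1 \<le> fst c \<and> fst c < int p \<and> 1 \<le> snd c \<and> snd c < int q"
  by (cases c) (auto simp: cells_def)

text \<open>The forced values outside \<open>cells p q\<close> pick a direction that stays inside if
  there is one, so only dead ends can be exits.\<close>

lemma step_extend_in_grid:
  assumes "u \<in> grid p q" "hstep u \<in> grid p q \<or> vstep u \<in> grid p q"
  shows "step (extend p q \<tau>) u \<in> grid p q"
  using assms hstep_in_grid_iff[OF assms(1)] vstep_in_grid_iff[OF assms(1)]
  by (auto simp: step_def extend_def mem_cells_iff)

text \<open>A vertex that both directions lead out of is a corner, and the parities of its
  coordinates decide which corner is possible.\<close>

lemma sink_cases:
  assumes "u \<in> grid p q" "hstep u \<notin> grid p q" "vstep u \<notin> grid p q"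
  shows "u = (int p, int q) \<and> odd p \<and> odd q \<or> u = (int p, 1) \<and> even p \<or> u = (1, int q) \<and> even q"
proof -
  obtain x y where u: "u = (x, y)" by fastforce
  have "odd y \<and> x = int p \<or> even y \<and> x = 1"
    using assms(1,2) by (cases "odd y") (auto simp: u hstep_def)
  moreover have "odd x \<and> y = int q \<or> even x \<and> y = 1"
    using assms(1,3) by (cases "odd x") (auto simp: u vstep_def)
  ultimately show ?thesis by (auto simp: u)
qed

lemma unique_exit:
  assumes "\<not> (even p \<and> even q)"
    and "u \<in> grid p q" "step (extend p q \<tau>) u \<notin> grid p q"
    and "w \<in> grid p q" "step (extend p q \<tau>) w \<notin> grid p q"
  shows "u = w"
proof -
  have "v = (int p, int q) \<and> odd p \<and> odd q \<or> v = (int p, 1) \<and> even p \<or> v = (1, int q) \<and> even q"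
    if "v \<in> grid p q" "step (extend p q \<tau>) v \<notin> grid p q" for v
    using sink_cases[OF that(1)] step_extend_in_grid[OF that(1)] that(2) by metis
  from this[OF assms(2,3)] this[OF assms(4,5)] show ?thesis using assms(1) by metis
qed

text \<open>For even \<open>p\<close> and \<open>q\<close> both \<open>(int p, 1)\<close> and
  \<open>(1, int q)\<close> are dead ends, but only the last vertex of a path can be one.\<close>

lemma hamiltonian_path_imp_odd:
  assumes "p > 0" "q > 0" "hamiltonian_path (DGG p q) vs"
  shows "\<not> (even p \<and> even q)"
proof
  assume ev: "even p \<and> even q"
  have vs: "vs \<noteq> []" "set vs = grid p q"
    and arcs: "\<And>i. Suc i < length vs \<Longrightarrow> vs ! Suc i = hstep (vs ! i) \<or> vs ! Suc i = vstep (vs ! i)"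
    using assms(3) by (auto simp: hamiltonian_path_iff)
  have sink_last: "u = last vs" if u: "u \<in> grid p q" "hstep u \<notin> grid p q" "vstep u \<notin> grid p q" for u
  proof -
    obtain i where i: "i < length vs" "vs ! i = u"
      using u(1) vs(2) in_set_conv_nth[of u vs] by auto
    have "\<not> Suc i < length vs"
    proof
      assume *: "Suc i < length vs"
      then have "vs ! Suc i \<in> grid p q" using nth_mem vs(2) by blast
      then show False using arcs[OF *] i(2) u(2,3) by auto
    qed
    then have "i = length vs - 1" using i(1) by linarith
    then show ?thesis using i(2) vs(1) by (simp add: last_conv_nth)
  qed
  have "(int p, 1) = last vs" "(1, int q) = last vs"
    using ev assms(1,2) by (intro sink_last; simp add: hstep_def vstep_def)+
  then have "int p = 1" by (metis prod.inject)
  then show False using ev by simp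
qed

section \<open>Hamiltonian paths as orbits of a step map\<close>

lemma hamiltonian_path_follows:
  assumes "hamiltonian_path (DGG p q) vs"
  obtains \<tau> where "follows (extend p q \<tau>) vs"
proof -
  have vs: "distinct vs" "set vs = grid p q"
    and arcs: "\<And>i. Suc i < length vs \<Longrightarrow> vs ! Suc i = hstep (vs ! i) \<or> vs ! Suc i = vstep (vs ! i)"
    using assms by (auto simp: hamiltonian_path_iff)
  define \<tau> where
    "\<tau> c \<longleftrightarrow> (\<exists>i. Suc i < length vs \<and> out_cell (vs ! i) = c \<and> vs ! Suc i = hstep (vs ! i))" for c
  have "vs ! Suc i = step (extend p q \<tau>) (vs ! i)" if i: "Suc i < length vs" for i
  proof -
    let ?u = "vs ! i"
    have u: "?u \<in> grid p q" and v: "vs ! Suc i \<in> grid p q"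
      using i vs(2) nth_mem Suc_lessD by blast+
    show ?thesis
    proof (cases "vs ! Suc i = hstep ?u")
      case True
      then have "extend p q \<tau> (out_cell ?u)"
        using i v hstep_in_grid_iff[OF u] by (auto simp: extend_def \<tau>_def)
      then show ?thesis using True by (simp add: step_def)
    next
      case False
      then have v_eq: "vs ! Suc i = vstep ?u" using arcs[OF i] by blast
      \<comment> \<open>If the other tail of the black cell used its horizontal arc, both arcs would
        end at the same vertex, which the path visits only once.\<close>
      have "\<not> \<tau> (out_cell ?u)"
      proof
        assume "\<tau> (out_cell ?u)"
        then obtain j where j: "Suc j < length vs" "out_cell (vs ! j) = out_cell ?u"
          "vs ! Suc j = hstep (vs ! j)" by (auto simp: \<tau>_def)
        then have "vs ! j \<noteq> ?u"
          using False i vs(1) by (metis Suc_lessD nth_eq_iff_index_eq)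
        then have "vs ! Suc j = vs ! Suc i"
          using hstep_opposite_corner[of ?u "vs ! j"] j v_eq by simp
        then show False
          using i j(1) vs(1) \<open>vs ! j \<noteq> ?u\<close> by (simp add: nth_eq_iff_index_eq)
      qed
      then have "\<not> extend p q \<tau> (out_cell ?u)"
        using v v_eq vstep_in_grid_iff[OF u] by (auto simp: extend_def mem_cells_iff)
      then show ?thesis using v_eq by (simp add: step_def)
    qed
  qed
  then have "follows (extend p q \<tau>) vs" by (simp add: follows_def)
  then show thesis by (rule that)
qed

text \<open>Arcs into \<open>(1, 1)\<close> come from outside the grid, so nothing can precede it on
  the path.\<close>

lemma hamiltonian_path_first:
  assumes us: "hamiltonian_path (DGG p q) us" "follows \<sigma> us"
  shows "us ! 0 = (1, 1)"
proof -
  have ne: "us \<noteq> []" and set: "set us = grid p q"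
    using us(1) by (auto simp: hamiltonian_path_iff)
  then have "us ! 0 \<in> grid p q" by (metis length_greater_0_conv nth_mem)
  then have "(1, 1) \<in> grid p q" by auto
  then obtain k where k: "k < length us" "us ! k = (1, 1)"
    using set in_set_conv_nth[of "(1, 1)" us] by auto
  have "k = 0"
  proof (rule ccontr)
    assume "k \<noteq> 0"
    then obtain k' where "k = Suc k'" using not0_implies_Suc by blast
    then have "step \<sigma> (us ! k') = (1, 1)" "us ! k' \<in> grid p q"
      using us(2) k nth_mem[of k' us] set by (auto simp: follows_def)
    then show False using step_neq_source by metis
  qed
  then show ?thesis using k by simp
qed

text \<open>A step back into the grid would hit the path at its first vertex, which no step from the
  grid reaches, or at a vertex with another predecessor, against injectivity.\<close>

lemma hamiltonian_path_last:
  assumes vs: "hamiltonian_path (DGG p q) vs" "follows \<sigma> vs"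
  shows "step \<sigma> (last vs) \<notin> grid p q"
proof
  assume in_grid: "step \<sigma> (last vs) \<in> grid p q"
  have ne: "vs \<noteq> []" and dist: "distinct vs" and set: "set vs = grid p q"
    using vs(1) by (auto simp: hamiltonian_path_iff)
  obtain j where j: "j < length vs" "vs ! j = step \<sigma> (last vs)"
    using in_grid set in_set_conv_nth[of "step \<sigma> (last vs)" vs] by auto
  show False
  proof (cases j)
    case 0
    then have "step \<sigma> (last vs) = (1, 1)" using hamiltonian_path_first[OF vs] j by simp
    then show False using step_neq_source set ne last_in_set by metis
  next
    case (Suc i)
    then have "step \<sigma> (vs ! i) = step \<sigma> (last vs)" using vs(2) j by (simp add: follows_def)
    then have "vs ! i = vs ! (length vs - 1)" using ne by (simp add: inj_step last_conv_nth)
    then have "i = length vs - 1" using dist j(1) Suc ne by (simp add: nth_eq_iff_index_eq)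
    then show False using Suc j(1) by simp
  qed
qed

lemma hamiltonian_path_arcs:
  assumes vs: "hamiltonian_path (DGG p q) vs" "follows \<sigma> vs"
  shows "set (vwalk_arcs vs) = {(u, step \<sigma> u) | u. u \<in> grid p q \<and> step \<sigma> u \<in> grid p q}"
proof -
  have ne: "vs \<noteq> []" and set: "set vs = grid p q"
    using vs(1) by (auto simp: hamiltonian_path_iff)
  have 1: "(u, step \<sigma> u) \<in> set (vwalk_arcs vs)" if u: "u \<in> grid p q" "step \<sigma> u \<in> grid p q" for u
  proof -
    obtain i where i: "i < length vs" "vs ! i = u"
      using u(1) set in_set_conv_nth[of u vs] by auto
    have "i \<noteq> length vs - 1"
      using hamiltonian_path_last[OF vs] u(2) i(2) ne by (auto simp: last_conv_nth)
    then have "Suc i < length vs" using i(1) by linarith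
    then show ?thesis using vs(2) i(2) by (auto simp: set_vwalk_arcs follows_def)
  qed
  have 2: "\<exists>u. e = (u, step \<sigma> u) \<and> u \<in> grid p q \<and> step \<sigma> u \<in> grid p q"
    if e: "e \<in> set (vwalk_arcs vs)" for e
  proof -
    obtain i where i: "Suc i < length vs" "e = (vs ! i, vs ! Suc i)"
      using e by (auto simp: set_vwalk_arcs)
    moreover have "vs ! i \<in> grid p q" "vs ! Suc i \<in> grid p q"
      using i(1) set nth_mem Suc_lessD by blast+
    ultimately show ?thesis using vs(2) by (auto simp: follows_def)
  qed
  show ?thesis
  proof (rule subset_antisym; rule subsetI)
    fix e assume "e \<in> {(u, step \<sigma> u) | u. u \<in> grid p q \<and> step \<sigma> u \<in> grid p q}"
    then show "e \<in> set (vwalk_arcs vs)" using 1 by (elim CollectE exE conjE) simp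
  next
    fix e assume "e \<in> set (vwalk_arcs vs)"
    from 2[OF this] show "e \<in> {(u, step \<sigma> u) | u. u \<in> grid p q \<and> step \<sigma> u \<in> grid p q}"
      by (rule CollectI)
  qed
qed

text \<open>From a vertex of \<open>S\<close> the path stays in \<open>S\<close> up to its last
  vertex, whose step leaves the grid.\<close>

lemma hamiltonian_path_no_closed_set:
  assumes vs: "hamiltonian_path (DGG p q) vs" "follows \<sigma> vs"
    and S: "S \<noteq> {}" "S \<subseteq> grid p q" "step \<sigma> ` S \<subseteq> S"
  shows False
proof -
  have ne: "vs \<noteq> []" and set: "set vs = grid p q"
    using vs(1) by (auto simp: hamiltonian_path_iff)
  obtain u where "u \<in> S" using S(1) by blast
  then obtain i where i: "i < length vs" "vs ! i \<in> S"
    using S(2) set in_set_conv_nth[of u vs] by auto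
  have "vs ! (i + k) \<in> S" if "i + k < length vs" for k
    using that
  proof (induction k)
    case (Suc k)
    then have "vs ! (i + Suc k) = step \<sigma> (vs ! (i + k))" using vs(2) by (simp add: follows_def)
    then show ?case using Suc S(3) by auto
  qed (use i in simp)
  from this[of "length vs - 1 - i"] have "last vs \<in> S"
    using i(1) ne by (simp add: last_conv_nth)
  then show False using hamiltonian_path_last[OF vs] S(2,3) by blast
qed

lemma hamiltonian_path_unique:
  assumes vs: "hamiltonian_path (DGG p q) vs" "follows \<sigma> vs"
    and ws: "hamiltonian_path (DGG p q) ws" "follows \<sigma> ws"
  shows "vs = ws"
proof -
  have len: "length vs = length ws"
    using vs(1) ws(1) distinct_card by (metis hamiltonian_path_iff)
  have "vs ! i = ws ! i" if "i < length vs" for i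
    using that
  proof (induction i)
    case 0
    then show ?case using hamiltonian_path_first vs ws by metis
  next
    case (Suc i)
    then show ?case using vs(2) ws(2) len by (simp add: follows_def)
  qed
  then show ?thesis using len by (intro nth_equalityI) auto
qed

text \<open>The path is the orbit of \<open>(1, 1)\<close> up to its first exit. The vertices it
  misses would form a closed set.\<close>

lemma hamiltonian_path_exists:
  assumes "p > 0" "q > 0" "\<not> (even p \<and> even q)"
    and no_closed: "\<And>S. S \<noteq> {} \<Longrightarrow> S \<subseteq> grid p q \<Longrightarrow> step (extend p q \<tau>) ` S \<subseteq> S \<Longrightarrow> False"
  obtains vs where "hamiltonian_path (DGG p q) vs" "follows (extend p q \<tau>) vs"
proof -
  let ?s = "step (extend p q \<tau>)"
  define orb where "orb i = (?s ^^ i) (1, 1)" for i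
  have o_Suc: "orb (Suc i) = ?s (orb i)" for i by (simp add: orb_def)
  have o0: "orb 0 = (1, 1)" by (simp add: orb_def)
  have "\<exists>n. orb n \<notin> grid p q"
  proof (rule ccontr)
    assume "\<nexists>n. orb n \<notin> grid p q"
    then have "range orb \<subseteq> grid p q" by blast
    moreover have "?s ` range orb \<subseteq> range orb" by (auto simp flip: o_Suc)
    ultimately show False using no_closed[of "range orb"] by blast
  qed
  then obtain n where n: "orb n \<notin> grid p q" and least: "\<And>i. i < n \<Longrightarrow> orb i \<in> grid p q"
    using exists_least_iff[of "\<lambda>n. orb n \<notin> grid p q"] by blast
  have "n \<noteq> 0" using n o0 assms(1,2) by (cases "n = 0") auto
  then obtain N where N: "n = Suc N" using not0_implies_Suc by blast
  \<comment> \<open>By injectivity a repetition could be pulled back to a return to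
    \<open>(1, 1)\<close>.\<close>
  have o_inj: "orb i \<noteq> orb j" if "i < j" "j < n" for i j
    using that
  proof (induction i arbitrary: j)
    case 0
    then obtain j' where "j = Suc j'" using gr0_implies_Suc by blast
    then show ?case using step_neq_source[OF least[of j']] 0 by (metis Suc_lessD o0 o_Suc)
  next
    case (Suc i)
    then obtain j' where "j = Suc j'" using less_imp_Suc_add by (metis Suc_lessE)
    then show ?case using Suc.IH[of j'] Suc.prems by (simp add: o_Suc inj_step)
  qed
  define vs where "vs = map orb [0..<n]"
  have nth: "vs ! i = orb i" if "i < n" for i using that by (simp add: vs_def)
  have len: "length vs = n" by (simp add: vs_def)
  have set: "set vs = orb ` {..<n}" by (auto simp: vs_def)
  have "distinct vs"
    unfolding distinct_conv_nth len using nth o_inj by (metis linorder_neqE_nat)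
  moreover have "set vs = grid p q"
  proof -
    have "u \<in> set vs" if "u \<in> grid p q" for u
    proof (rule ccontr)
      assume "u \<notin> set vs"
      \<comment> \<open>A missed vertex is not the unique exit \<open>orb N\<close>, so its step
        stays in the grid, and injectivity keeps it off the orbit.\<close>
      have "?s w \<in> grid p q - set vs" if w: "w \<in> grid p q - set vs" for w
      proof -
        have "orb N \<in> grid p q" "?s (orb N) \<notin> grid p q" using least n N by (auto simp: o_Suc)
        moreover have "w \<noteq> orb N" using w N by (auto simp: set)
        ultimately have in_grid: "?s w \<in> grid p q" using unique_exit[OF assms(3)] w by (metis DiffD1)
        have "?s w \<noteq> orb i" if "i < n" for i
        proof (cases i)
          case 0
          then show ?thesis using step_neq_source w by (metis DiffD1 o0)
        next
          case (Suc j)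
          then have "w \<noteq> orb j" using w that by (auto simp: set)
          then show ?thesis using Suc by (simp add: o_Suc inj_step)
        qed
        then show ?thesis using in_grid by (auto simp: set)
      qed
      then have "?s ` (grid p q - set vs) \<subseteq> grid p q - set vs" by (rule image_subsetI)
      moreover have "grid p q - set vs \<noteq> {}"
        using \<open>u \<notin> set vs\<close> \<open>u \<in> grid p q\<close> by (metis DiffI empty_iff)
      ultimately show False using no_closed by (metis Diff_subset)
    qed
    then have "grid p q \<subseteq> set vs" by (rule subsetI)
    moreover have "set vs \<subseteq> grid p q"
      unfolding set using least by (metis image_subsetI lessThan_iff)
    ultimately show ?thesis by (metis subset_antisym)
  qed
  moreover have flw: "follows (extend p q \<tau>) vs"
    by (simp add: follows_def len nth o_Suc)
  moreover have "vs \<noteq> []" using len N by auto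
  ultimately have "hamiltonian_path (DGG p q) vs"
    unfolding hamiltonian_path_iff follows_def step_def by metis
  then show thesis using flw that by blast
qed

section \<open>Matchings of the cells\<close>

text \<open>At a black cell \<open>\<sigma>\<close> fixes the axis on which passable neighbours lie,
  which leaves one opposite pair.\<close>

lemma passable_neighbours_of_black:
  assumes "black c" "adjacent c d" "passable \<sigma> c d" "adjacent c e" "passable \<sigma> c e"
  shows "e = d \<or> e = (2 * fst c - fst d, 2 * snd c - snd d)"
proof -
  have unit: "j = k \<or> j = 2 * i - k" if "\<bar>i - k\<bar> = 1" "\<bar>i - j\<bar> = 1" for i j k :: int
    using that by linarith
  show ?thesis
  proof (cases "\<sigma> c")
    case True
    then have eq: "snd d = snd c" "snd e = snd c" using assms(1,3,5) by (auto simp: passable_def)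
    then have "\<bar>fst c - fst d\<bar> = 1" "\<bar>fst c - fst e\<bar> = 1"
      using assms(2,4) by (auto simp: adjacent_def)
    from unit[OF this] show ?thesis unfolding prod_eq_iff by (simp add: eq)
  next
    case False
    then have "snd c \<noteq> snd d" "snd c \<noteq> snd e" using assms(1,3,5) by (auto simp: passable_def)
    then have eq: "fst d = fst c" "fst e = fst c"
      and "\<bar>snd c - snd d\<bar> = 1" "\<bar>snd c - snd e\<bar> = 1"
      using assms(2,4) by (auto simp: adjacent_def)
    from unit[OF this(3,4)] show ?thesis unfolding prod_eq_iff by (simp add: eq)
  qed
qed

text \<open>The cells on which the matchings differ are closed under \<open>across m'\<close>: at a
  black one \<open>m\<close> must take the passable neighbour opposite to the one taken by
  \<open>m'\<close>.\<close>

lemma matching_unique: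
  assumes m: "matching C m" "\<And>c. c \<in> C \<Longrightarrow> passable \<sigma> c (m c)"
    and m': "matching C m'" "\<And>c. c \<in> C \<Longrightarrow> passable \<sigma> c (m' c)"
    and no_closed: "\<And>R. R \<noteq> {} \<Longrightarrow> R \<subseteq> C \<Longrightarrow> across m' ` R \<subseteq> R \<Longrightarrow> False"
  shows "\<forall>c\<in>C. m c = m' c"
proof (rule ccontr)
  define D where "D = {c \<in> C. m c \<noteq> m' c}"
  assume "\<not> (\<forall>c\<in>C. m c = m' c)"
  then have "D \<noteq> {}" by (auto simp: D_def)
  moreover have "D \<subseteq> C" by (auto simp: D_def)
  moreover have "across m' c \<in> D" if c: "c \<in> D" for c
  proof -
    have C: "c \<in> C" and ne: "m c \<noteq> m' c" using c by (auto simp: D_def)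
    have mc: "m c \<in> C" "m (m c) = c" "adjacent c (m c)"
      using m(1) C by (auto simp: matching_def)
    have m'c: "m' c \<in> C" "m' (m' c) = c" "adjacent c (m' c)"
      using m'(1) C by (auto simp: matching_def)
    show ?thesis
    proof (cases "black c")
      case True
      then have "m c = across m' c"
        using passable_neighbours_of_black[OF True m'c(3) m'(2)[OF C] mc(3) m(2)[OF C]] ne
        by (simp add: across_def)
      moreover have "m' (m c) \<noteq> c"
        using m'(1) mc(1) ne by (metis matching_def)
      ultimately show ?thesis using mc by (simp add: D_def)
    next
      case False
      have "m (m' c) \<noteq> c"
        using m(1) m'c(1) ne by (metis matching_def)
      then show ?thesis using m'c False by (simp add: D_def across_def)
    qed
  qed
  ultimately show False using no_closed[of D] by blast
qed

section \<open>Parity and colour counts of the cells\<close>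

lemma finite_cells: "finite (cells p q)"
  by (simp add: cells_def)

text \<open>Partners have opposite colours, so the number \<open>(p - 1) * (q - 1)\<close> of cells
  is even.\<close>

lemma matching_imp_odd:
  assumes "p > 0" "q > 0" "matching (cells p q) m"
  shows "\<not> (even p \<and> even q)"
proof
  assume ev: "even p \<and> even q"
  let ?B = "{c \<in> cells p q. black c}" and ?W = "{c \<in> cells p q. \<not> black c}"
  have "m c \<in> cells p q \<and> m (m c) = c \<and> (black (m c) \<longleftrightarrow> \<not> black c)" if "c \<in> cells p q" for c
    using that assms(3) black_adjacent by (metis matching_def)
  then have "bij_betw m ?B ?W"
    by (intro bij_betw_byWitness[where f' = m]) (simp_all add: image_subset_iff)
  then have "card ?B = card ?W" by (rule bij_betw_same_card)
  moreover have "card (cells p q) = card ?B + card ?W"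
    using finite_cells by (subst card_Un_disjoint[symmetric]) (auto intro: arg_cong[where f = card])
  ultimately have "even (card (cells p q))" by simp
  moreover have "card (cells p q) = (p - 1) * (q - 1)"
    by (simp add: cells_def card_cartesian_product nat_minus_as_int)
  ultimately show False using ev assms(1,2) by simp
qed

lemma card_black_cells:
  assumes "\<not> (even p \<and> even q)"
  shows "card {c \<in> cells p q. black c} = card {c \<in> cells p q. \<not> black c}"
proof -
  \<comment> \<open>A reflection along a direction with an odd number of vertices changes the parity
    of one coordinate and so swaps the colours.\<close>
  define r :: "int \<times> int \<Rightarrow> int \<times> int" where
    "r c = (if odd p then (int p - fst c, snd c) else (fst c, int q - snd c))" for c
  have "bij_betw r {c \<in> cells p q. black c} {c \<in> cells p q. \<not> black c}"
    using assms
    by (intro bij_betw_byWitness[where f' = r]) (auto simp: r_def cells_def black_def)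
  then show ?thesis by (rule bij_betw_same_card)
qed

text \<open>Applied to the cells that passable sides do not connect to the outside, this makes the
  distance to the outside in \<open>matching_exists\<close> finite.\<close>

lemma no_trapped_cells:
  assumes U: "U \<noteq> {}" "U \<subseteq> cells p q"
    and closed: "\<And>c d. adjacent c d \<Longrightarrow> passable \<sigma> c d \<Longrightarrow> c \<in> U \<Longrightarrow> d \<in> U"
    and no_closed: "\<And>S. S \<noteq> {} \<Longrightarrow> S \<subseteq> grid p q \<Longrightarrow> step \<sigma> ` S \<subseteq> S \<Longrightarrow> False"
  shows False
proof -
  \<comment> \<open>Steps that start on the boundary of \<open>U\<close> run along it, as no side of the boundary is passable.\<close>
  define N where "N x y \<longleftrightarrow> \<not> (((x, y) \<in> U \<longleftrightarrow> (x - 1, y) \<in> U) \<and> ((x, y) \<in> U \<longleftrightarrow> (x, y - 1) \<in> U)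
      \<and> ((x, y) \<in> U \<longleftrightarrow> (x - 1, y - 1) \<in> U))" for x y
  define S where "S = {(x, y). N x y}"
  have iff: "c \<in> U \<longleftrightarrow> d \<in> U" if "adjacent c d" "passable \<sigma> c d" for c d
    using closed that adjacent_sym passable_sym by blast
  have "step \<sigma> (x, y) \<in> S" if "N x y" for x y
  proof -
    have 1: "(x, y) \<in> U \<longleftrightarrow> (x - 1, y) \<in> U" if "passable \<sigma> (x, y) (x - 1, y)"
      using that by (intro iff) (auto simp: adjacent_def)
    have 2: "(x, y) \<in> U \<longleftrightarrow> (x, y - 1) \<in> U" if "passable \<sigma> (x, y) (x, y - 1)"
      using that by (intro iff) (auto simp: adjacent_def)
    have 3: "(x, y - 1) \<in> U \<longleftrightarrow> (x - 1, y - 1) \<in> U" if "passable \<sigma> (x, y - 1) (x - 1, y - 1)"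
      using that by (intro iff) (auto simp: adjacent_def)
    have 4: "(x - 1, y) \<in> U \<longleftrightarrow> (x - 1, y - 1) \<in> U" if "passable \<sigma> (x - 1, y) (x - 1, y - 1)"
      using that by (intro iff) (auto simp: adjacent_def)
    \<comment> \<open>One of the two arcs out of the vertex is passable, and so is one of the two
      arcs into it. Membership in \<open>U\<close> changes an even, nonzero number of times around
      the vertex, hence at both remaining sides, one of which is the step.\<close>
    show ?thesis
      using that 1 2 3 4
      by (cases "odd x"; cases "odd y"; cases "\<sigma> (out_cell (x, y))"; cases "\<sigma> (in_cell (x, y))")
         (simp_all add: passable_def S_def N_def step_def step_defs, argo+)
  qed
  then have "step \<sigma> u \<in> S" if "u \<in> S" for u
    using that by (cases u) (simp add: S_def)
  then have "step \<sigma> ` S \<subseteq> S" by (rule image_subsetI)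
  moreover have "S \<subseteq> grid p q"
    using U(2) by (auto simp: S_def N_def cells_def)
  moreover have "S \<noteq> {}"
  proof -
    obtain x y where xy: "(x, y) \<in> U" using U(1) by auto
    \<comment> \<open>Going left from a cell of \<open>U\<close> one leaves \<open>U\<close>
      eventually. The lower left corner of the last cell before that is on the boundary.\<close>
    have "\<exists>k. (x - int k, y) \<notin> U"
    proof
      show "(x - int (nat x), y) \<notin> U" using U(2) by (auto simp: cells_def)
    qed
    then obtain k where k: "(x - int k, y) \<notin> U" "\<And>i. i < k \<Longrightarrow> (x - int i, y) \<in> U"
      using exists_least_iff[of "\<lambda>k. (x - int k, y) \<notin> U"] by blast
    have "k \<noteq> 0" using k(1) xy by (cases "k = 0") auto
    then obtain i where i: "k = Suc i" using not0_implies_Suc by blast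
    have "(x - int i, y) \<in> U" "(x - int i - 1, y) \<notin> U"
      using k i by (simp_all add: algebra_simps)
    then have "(x - int i, y) \<in> S" by (simp add: S_def N_def)
    then show ?thesis by blast
  qed
  ultimately show False using no_closed by blast
qed

text \<open>A neighbour outside the grid is black here, and its forced choice puts a step on the
  common side. Hence parents of white cells are cells of the grid.\<close>

lemma white_border_not_passable:
  assumes "w \<in> cells p q" "\<not> black w" "adjacent w d" "passable (extend p q \<tau>) w d"
  shows "d \<in> cells p q"
  using assms by (elim adjacent_cases) (auto simp: passable_def extend_def cells_def split: if_splits)

lemma matching_exists:
  fixes p q :: nat and \<tau> :: "int \<times> int \<Rightarrow> bool"
  defines "\<sigma> \<equiv> extend p q \<tau>"
  assumes odd: "\<not> (even p \<and> even q)"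
    and no_closed: "\<And>S. S \<noteq> {} \<Longrightarrow> S \<subseteq> grid p q \<Longrightarrow> step \<sigma> ` S \<subseteq> S \<Longrightarrow> False"
  obtains m where "matching (cells p q) m" "\<And>c. c \<in> cells p q \<Longrightarrow> passable \<sigma> c (m c)"
proof -
  let ?C = "cells p q"
  define r where "r = {(c, d). c \<in> ?C \<and> adjacent c d \<and> passable \<sigma> c d}"
  define reach where "reach n c \<longleftrightarrow> (\<exists>e. e \<notin> ?C \<and> (c, e) \<in> r ^^ n)" for n c
  define U where "U = {c \<in> ?C. \<not> (\<exists>n. reach n c)}"
  have U_closed: "d \<in> U" if cd: "adjacent c d" "passable \<sigma> c d" "c \<in> U" for c d
  proof -
    have "(c, d) \<in> r" using cd by (auto simp: r_def U_def)
    then have "reach (Suc n) c" if "reach n d" for n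
      using that relpow_Suc_I2 by (fastforce simp: reach_def)
    then have no: "\<not> reach n d" for n using cd(3) by (auto simp: U_def)
    have "(d, d) \<in> r ^^ 0" by simp
    then have "d \<in> ?C" using no[of 0] unfolding reach_def by blast
    then show ?thesis using no by (simp add: U_def)
  qed
  have "U = {}"
    using no_trapped_cells[of U p q \<sigma>] U_closed no_closed by (metis (no_types, lifting) U_def mem_Collect_eq subsetI)
  then have ex_reach: "\<exists>n. reach n c" if "c \<in> ?C" for c
    using that \<open>U = {}\<close> unfolding U_def by blast
  \<comment> \<open>Distance to the outside through passable sides; cells outside the grid have
    depth 0. The map \<open>up\<close> obtained below chooses a parent of smaller depth.\<close>
  define depth where "depth c = (LEAST n. reach n c)" for c
  have "\<exists>d. adjacent c d \<and> passable \<sigma> c d \<and> depth d < depth c" if c: "c \<in> ?C" for c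
  proof -
    have least: "reach (depth c) c"
      using ex_reach[OF c] LeastI_ex by (metis depth_def)
    then have "depth c \<noteq> 0" using c by (cases "depth c = 0") (auto simp: reach_def)
    then obtain k where k: "depth c = Suc k" using not0_implies_Suc by blast
    with least obtain e where e: "e \<notin> ?C" "(c, e) \<in> r ^^ Suc k" by (auto simp: reach_def)
    from relpow_Suc_D2[OF e(2)] obtain d where d: "(c, d) \<in> r" "(d, e) \<in> r ^^ k" by blast
    then have "reach k d" using e(1) d(2) unfolding reach_def by blast
    then have "depth d \<le> k" unfolding depth_def by (rule Least_le)
    then have "adjacent c d \<and> passable \<sigma> c d \<and> depth d < depth c"
      using d(1) k by (simp add: r_def)
    then show ?thesis by blast
  qed
  then obtain up where up: "\<And>c. c \<in> ?C \<Longrightarrow> adjacent c (up c)"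
    "\<And>c. c \<in> ?C \<Longrightarrow> passable \<sigma> c (up c)" "\<And>c. c \<in> ?C \<Longrightarrow> depth (up c) < depth c"
    by metis
  let ?B = "{c \<in> ?C. black c}" and ?W = "{c \<in> ?C. \<not> black c}"
  have up_B: "up w \<in> ?B" if "w \<in> ?W" for w
    using that up(1,2)[of w] white_border_not_passable[of w p q "up w" \<tau>] black_adjacent[of w "up w"]
    by (simp add: \<sigma>_def)
  \<comment> \<open>One of the two passable neighbours of a black cell is its own parent, of smaller
    depth. A child has larger depth, so it must be the other one.\<close>
  have inj: "inj_on up ?W"
  proof (rule inj_onI)
    fix v w assume vw: "v \<in> ?W" "w \<in> ?W" and eq: "up v = up w"
    define b where "b = up v"
    have b: "b \<in> ?C" "black b" using up_B[OF vw(1)] by (auto simp: b_def)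
    have v: "adjacent b v" "passable \<sigma> b v" "depth b < depth v"
      using vw(1) up[of v] adjacent_sym passable_sym by (auto simp: b_def)
    have w: "adjacent b w" "passable \<sigma> b w" "depth b < depth w"
      using vw(2) up[of w] adjacent_sym passable_sym by (auto simp: b_def eq)
    let ?d = "up b"
    have d: "adjacent b ?d" "passable \<sigma> b ?d" "depth ?d < depth b" using up b(1) by auto
    have "v \<noteq> ?d" "w \<noteq> ?d" using v(3) w(3) d(3) by auto
    then show "v = w"
      using passable_neighbours_of_black[OF b(2) d(1,2) v(1,2)]
        passable_neighbours_of_black[OF b(2) d(1,2) w(1,2)] by simp
  qed
  \<comment> \<open>There are as many black cells as white ones.\<close>
  have surj: "up ` ?W = ?B"
  proof (rule card_seteq)
    show "finite ?B" using finite_cells by simp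
    show "up ` ?W \<subseteq> ?B" using up_B by (rule image_subsetI)
    show "card ?B \<le> card (up ` ?W)"
      using card_black_cells[OF odd] card_image[OF inj] by simp
  qed
  define m where "m c = (if black c then inv_into ?W up c else up c)" for c
  have "m c \<in> ?C \<and> adjacent c (m c) \<and> m (m c) = c \<and> passable \<sigma> c (m c)" if c: "c \<in> ?C" for c
  proof (cases "black c")
    case True
    then have "c \<in> up ` ?W" using surj c by simp
    then obtain w where w: "w \<in> ?W" "up w = c" by blast
    have "m c = w" using w inj True by (auto simp: m_def)
    then show ?thesis
      using w up[of w] adjacent_sym[of w c] passable_sym[of w c] by (simp add: m_def)
  next
    case False
    then have "up c \<in> ?B" using up_B c by simp
    then show ?thesis using False c up inj by (simp add: m_def)
  qed
  then show thesis by (intro that[of m]) (simp_all add: matching_def)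
qed

section \<open>Domino tilings as matchings\<close>

definition domino_of :: "int \<times> int \<Rightarrow> int \<times> int \<Rightarrow> (real \<times> real) set" where
  "domino_of c d = cbox (pt (min (fst c) (fst d), min (snd c) (snd d)))
                        (pt (max (fst c) (fst d) + 1, max (snd c) (snd d) + 1))"

text \<open>Centres are test points: none lies on the border of a box with integer corners.\<close>

definition center :: "int \<times> int \<Rightarrow> real \<times> real" where
  "center c = (real_of_int (fst c) + 1 / 2, real_of_int (snd c) + 1 / 2)"

lemma cbox_pt: "cbox (pt (a, b)) (pt (c, d)) = {real_of_int a..real_of_int c} \<times> {real_of_int b..real_of_int d}"
  by (simp add: pt_def cbox_Pair_eq)

lemma interior_cbox_pt:
  "interior (cbox (pt (a, b)) (pt (c, d))) = {real_of_int a<..<real_of_int c} \<times> {real_of_int b<..<real_of_int d}"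
  by (simp add: cbox_pt interior_Times)

lemma center_mem_cbox_pt:
  "center e \<in> cbox (pt (a, b)) (pt (c, d)) \<longleftrightarrow> a \<le> fst e \<and> fst e < c \<and> b \<le> snd e \<and> snd e < d"
proof -
  have "real_of_int m \<le> real_of_int k + 1 / 2 \<longleftrightarrow> m \<le> k" "real_of_int k + 1 / 2 \<le> real_of_int m \<longleftrightarrow> k < m"
    for m k :: int by linarith+
  then show ?thesis by (simp add: cbox_pt center_def conj_assoc)
qed

lemma center_mem_interior_cbox_pt:
  "center e \<in> interior (cbox (pt (a, b)) (pt (c, d))) \<longleftrightarrow> a \<le> fst e \<and> fst e < c \<and> b \<le> snd e \<and> snd e < d"
proof -
  have "real_of_int m < real_of_int k + 1 / 2 \<longleftrightarrow> m \<le> k" "real_of_int k + 1 / 2 < real_of_int m \<longleftrightarrow> k < m"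
    for m k :: int by linarith+
  then show ?thesis unfolding interior_cbox_pt center_def by (simp add: conj_assoc)
qed

lemma domino_of_sym: "domino_of c d = domino_of d c"
  by (simp add: domino_of_def min.commute max.commute)

lemma center_mem_domino_of:
  assumes "adjacent c d"
  shows "center e \<in> domino_of c d \<longleftrightarrow> e = c \<or> e = d"
  using assms unfolding domino_of_def center_mem_cbox_pt prod_eq_iff adjacent_def by linarith

lemma sum_two_squares_5:
  fixes u v :: int
  assumes "u\<^sup>2 + v\<^sup>2 = 5" "0 < u" "0 < v"
  shows "u = 1 \<and> v = 2 \<or> u = 2 \<and> v = 1"
proof -
  have "w < 3" if "w\<^sup>2 + z\<^sup>2 = 5" "0 < w" for w z :: int
  proof (rule ccontr)
    assume "\<not> w < 3"
    then have "3 ^ 2 \<le> w\<^sup>2" by (intro power_mono) auto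
    then show False using that zero_le_power2[of z] by simp
  qed
  from this[of u v] this[of v u] have "u = 1 \<or> u = 2" "v = 1 \<or> v = 2"
    using assms by (auto simp: add.commute)
  then show ?thesis using assms(1) by auto
qed

text \<open>The integer sides are 1 and 2, so the lower left and the upper right cell of the
  rectangle are its two cells.\<close>

lemma domino_iff:
  "domino p q D \<longleftrightarrow> (\<exists>c\<in>cells p q. \<exists>d\<in>cells p q. adjacent c d \<and> D = domino_of c d)"
proof
  assume "domino p q D"
  then obtain a b c d where abcd: "a < c" "b < d"
    "{(a, b), (c, b), (c, d), (a, d)} \<subseteq> pverts (DGG p q)"
    "dist (pt (a, b)) (pt (c, d)) = sqrt 5" "D = cbox (pt (a, b)) (pt (c, d))"
    unfolding domino_def by blast
  have "(real_of_int (c - a))\<^sup>2 + (real_of_int (d - b))\<^sup>2 = 5"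
    using abcd(4) by (simp add: pt_def dist_Pair_Pair dist_real_def power2_commute)
  then have "real_of_int ((c - a)\<^sup>2 + (d - b)\<^sup>2) = real_of_int 5" by simp
  then have "(c - a)\<^sup>2 + (d - b)\<^sup>2 = 5" by (simp only: of_int_eq_iff)
  then have sides: "c - a = 1 \<and> d - b = 2 \<or> c - a = 2 \<and> d - b = 1"
    using sum_two_squares_5 abcd(1,2) by simp
  have "adjacent (a, b) (c - 1, d - 1)" using sides by (auto simp: adjacent_def)
  moreover have "D = domino_of (a, b) (c - 1, d - 1)"
    using abcd(1,2,5) by (simp add: domino_of_def)
  moreover have "(a, b) \<in> cells p q" "(c - 1, d - 1) \<in> cells p q"
    using abcd(1-3) by (auto simp: cells_def DGG_def Let_def)
  ultimately show "\<exists>c\<in>cells p q. \<exists>d\<in>cells p q. adjacent c d \<and> D = domino_of c d" by blast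
next
  assume "\<exists>c\<in>cells p q. \<exists>d\<in>cells p q. adjacent c d \<and> D = domino_of c d"
  then obtain c d where cd: "c \<in> cells p q" "d \<in> cells p q" "adjacent c d" "D = domino_of c d"
    by blast
  let ?a = "min (fst c) (fst d)" and ?b = "min (snd c) (snd d)"
    and ?c = "max (fst c) (fst d) + 1" and ?d = "max (snd c) (snd d) + 1"
  have "?a < ?c" "?b < ?d" by linarith+
  moreover have "{(?a, ?b), (?c, ?b), (?c, ?d), (?a, ?d)} \<subseteq> pverts (DGG p q)"
    using cd(1,2) by (auto simp: cells_def DGG_def Let_def)
  moreover have "dist (pt (?a, ?b)) (pt (?c, ?d)) = sqrt 5"
    using cd(3) by (elim adjacent_cases) (simp_all add: pt_def dist_Pair_Pair dist_real_def)
  ultimately show "domino p q D" unfolding domino_def using cd(4) domino_of_def by blast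
qed

lemma domino_eq_cbox_pt:
  assumes "domino p q D"
  obtains a b c d where "a < c" "b < d" "1 \<le> a" "c \<le> int p" "1 \<le> b" "d \<le> int q"
    "D = cbox (pt (a, b)) (pt (c, d))"
proof -
  obtain a b c d where abcd: "a < c" "b < d"
    "{(a, b), (c, b), (c, d), (a, d)} \<subseteq> pverts (DGG p q)" "D = cbox (pt (a, b)) (pt (c, d))"
    using assms unfolding domino_def by blast
  then have "1 \<le> a" "c \<le> int p" "1 \<le> b" "d \<le> int q" by (auto simp: DGG_def Let_def)
  then show thesis using that abcd by blast
qed

text \<open>Reduces plane geometry to cell centres. If \<open>min p q = 1\<close> there are no cells
  and no dominoes, so the right-hand side also admits only the empty set.\<close>

lemma domino_tiling_iff:
  assumes "p > 0" "q > 0"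
  shows "domino_tiling p q T \<longleftrightarrow>
    (\<forall>D\<in>T. domino p q D) \<and> (\<forall>c\<in>cells p q. \<exists>!D. D \<in> T \<and> center c \<in> D)"
proof (cases "min p q = 1")
  case True
  then have "cells p q = {}" by (auto simp: cells_def min_def split: if_splits)
  then show ?thesis using True by (auto simp: domino_tiling_def domino_iff)
next
  case False
  then have pq: "2 \<le> p" "2 \<le> q" using assms by (auto simp: min_def split: if_splits)
  have main: "pairwise (\<lambda>D E. interior D \<inter> interior E = {}) T \<and> \<Union>T = cbox (pt (1, 1)) (pt (int p, int q)) \<longleftrightarrow>
      (\<forall>c\<in>cells p q. \<exists>!D. D \<in> T \<and> center c \<in> D)"
    if dom: "\<forall>D\<in>T. domino p q D"
  proof (intro iffI conjI ballI)
    fix c assume *: "pairwise (\<lambda>D E. interior D \<inter> interior E = {}) T \<and>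
      \<Union>T = cbox (pt (1, 1)) (pt (int p, int q))" and c: "c \<in> cells p q"
    have "center c \<in> cbox (pt (1, 1)) (pt (int p, int q))"
      using c by (auto simp: center_mem_cbox_pt cells_def)
    then obtain D where D: "D \<in> T" "center c \<in> D" using * by (metis UnionE)
    have int: "center c \<in> interior E" if E: "E \<in> T" "center c \<in> E" for E
    proof -
      obtain a b a' b' where "E = cbox (pt (a, b)) (pt (a', b'))"
        using dom E(1) by (metis domino_eq_cbox_pt)
      then show ?thesis using E(2) by (simp only: center_mem_interior_cbox_pt center_mem_cbox_pt)
    qed
    have "E = D" if E: "E \<in> T" "center c \<in> E" for E
    proof (rule ccontr)
      assume "E \<noteq> D"
      then have "interior E \<inter> interior D = {}"
        using pairwiseD[OF conjunct1[OF *] E(1) D(1)] by simp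
      then show False using IntI[OF int[OF E] int[OF D]] by simp
    qed
    then show "\<exists>!D. D \<in> T \<and> center c \<in> D" using D by blast
  next
    assume *: "\<forall>c\<in>cells p q. \<exists>!D. D \<in> T \<and> center c \<in> D"
    show "pairwise (\<lambda>D E. interior D \<inter> interior E = {}) T"
    proof (rule pairwiseI, rule ccontr)
      fix D E assume DE: "D \<in> T" "E \<in> T" "D \<noteq> E" "interior D \<inter> interior E \<noteq> {}"
      obtain a b c d where D: "1 \<le> a" "c \<le> int p" "1 \<le> b" "d \<le> int q" "D = cbox (pt (a, b)) (pt (c, d))"
        using dom DE(1) by (metis domino_eq_cbox_pt)
      obtain a' b' c' d' where E: "1 \<le> a'" "c' \<le> int p" "1 \<le> b'" "d' \<le> int q"
        "E = cbox (pt (a', b')) (pt (c', d'))"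
        using dom DE(2) by (metis domino_eq_cbox_pt)
      obtain r s where "(r, s) \<in> interior D" "(r, s) \<in> interior E" using DE(4) by auto
      then have "real_of_int (max a a') < real_of_int (min c c')"
        "real_of_int (max b b') < real_of_int (min d d')"
        unfolding D(5) E(5) interior_cbox_pt by auto
      then have less: "max a a' < min c c'" "max b b' < min d d'"
        by (simp_all only: of_int_less_iff)
      \<comment> \<open>Boxes with integer corners and overlapping interiors share the cell at the
        lower left corner of their intersection.\<close>
      let ?e = "(max a a', max b b')"
      have "?e \<in> cells p q" using less D(1-4) E(1-4) by (auto simp: cells_def)
      moreover have "center ?e \<in> D" "center ?e \<in> E"
        using less by (auto simp: D(5) E(5) center_mem_cbox_pt)
      ultimately show False using * DE(1-3) by blast
    qed
    show "\<Union>T = cbox (pt (1, 1)) (pt (int p, int q))"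
    proof (rule subset_antisym)
      show "\<Union>T \<subseteq> cbox (pt (1, 1)) (pt (int p, int q))"
      proof (rule Union_least)
        fix D assume "D \<in> T"
        then obtain a b c d where "1 \<le> a" "c \<le> int p" "1 \<le> b" "d \<le> int q"
          "D = cbox (pt (a, b)) (pt (c, d))"
          using dom by (metis domino_eq_cbox_pt)
        then have "1 \<le> real_of_int a" "real_of_int c \<le> real p" "1 \<le> real_of_int b"
          "real_of_int d \<le> real q" and "D = cbox (pt (a, b)) (pt (c, d))"
          by (linarith | simp)+
        then show "D \<subseteq> cbox (pt (1, 1)) (pt (int p, int q))"
          by (auto simp: cbox_pt)
      qed
      have "(r, s) \<in> \<Union>T" if rs: "1 \<le> r" "r \<le> real p" "1 \<le> s" "s \<le> real q" for r s
      proof -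
        \<comment> \<open>The cap assigns points on the right and upper border to the last column
          and row of cells.\<close>
        let ?x = "min \<lfloor>r\<rfloor> (int p - 1)" and ?y = "min \<lfloor>s\<rfloor> (int q - 1)"
        have x: "1 \<le> ?x" "?x < int p" "real_of_int ?x \<le> r" "r \<le> real_of_int ?x + 1"
          using rs(1,2) pq by (auto simp: min_def) linarith+
        have y: "1 \<le> ?y" "?y < int q" "real_of_int ?y \<le> s" "s \<le> real_of_int ?y + 1"
          using rs(3,4) pq by (auto simp: min_def) linarith+
        have "(?x, ?y) \<in> cells p q" using x(1,2) y(1,2) by (simp add: cells_def)
        then obtain D where D: "D \<in> T" "center (?x, ?y) \<in> D" using * by blast
        obtain a b c d where abcd: "D = cbox (pt (a, b)) (pt (c, d))"
          using dom D(1) by (metis domino_eq_cbox_pt)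
        have "a \<le> ?x" "?x < c" "b \<le> ?y" "?y < d"
          using D(2) unfolding abcd center_mem_cbox_pt by auto
        then have "real_of_int a \<le> real_of_int ?x" "real_of_int ?x + 1 \<le> real_of_int c"
          "real_of_int b \<le> real_of_int ?y" "real_of_int ?y + 1 \<le> real_of_int d"
          by linarith+
        then have "(r, s) \<in> D" using x y unfolding abcd cbox_pt by auto
        then show ?thesis using D(1) by blast
      qed
      then show "cbox (pt (1, 1)) (pt (int p, int q)) \<subseteq> \<Union>T"
        by (auto simp: cbox_pt)
    qed
  qed
  show ?thesis
    unfolding domino_tiling_def if_not_P[OF False] by (rule conj_cong[OF refl main])
qed

text \<open>The partner is the other cell of the domino covering the centre. Since that domino is
  unique, the choice is an involution.\<close>

lemma domino_tiling_imp_matching: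
  assumes "p > 0" "q > 0" "domino_tiling p q T"
  obtains m where "matching (cells p q) m" "T = (\<lambda>c. domino_of c (m c)) ` cells p q"
proof -
  have dom: "\<And>D. D \<in> T \<Longrightarrow> domino p q D"
    and uniq: "\<And>c. c \<in> cells p q \<Longrightarrow> \<exists>!D. D \<in> T \<and> center c \<in> D"
    using assms by (auto simp: domino_tiling_iff)
  have "\<exists>d. d \<in> cells p q \<and> adjacent c d \<and> domino_of c d \<in> T" if c: "c \<in> cells p q" for c
  proof -
    obtain D where D: "D \<in> T" "center c \<in> D" using uniq[OF c] by blast
    obtain a b where ab: "a \<in> cells p q" "b \<in> cells p q" "adjacent a b" "D = domino_of a b"
      using dom[OF D(1)] unfolding domino_iff by blast
    have "c = a \<or> c = b" using D(2) ab center_mem_domino_of by simp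
    then show ?thesis using ab D(1) adjacent_sym domino_of_sym by metis
  qed
  then obtain m where m: "\<And>c. c \<in> cells p q \<Longrightarrow> m c \<in> cells p q"
    "\<And>c. c \<in> cells p q \<Longrightarrow> adjacent c (m c)" "\<And>c. c \<in> cells p q \<Longrightarrow> domino_of c (m c) \<in> T"
    by metis
  have mem: "center c \<in> domino_of c (m c)" "center (m c) \<in> domino_of c (m c)" if "c \<in> cells p q" for c
    using center_mem_domino_of m(2)[OF that] by blast+
  have "m (m c) = c" if c: "c \<in> cells p q" for c
  proof -
    have "domino_of (m c) (m (m c)) = domino_of c (m c)"
      using uniq[of "m c"] m(1,3) mem c by metis
    then have "center (m (m c)) \<in> domino_of c (m c)" using mem(2)[OF m(1)[OF c]] by simp
    then have "m (m c) = c \<or> m (m c) = m c" using center_mem_domino_of m(2)[OF c] by simp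
    then show ?thesis using m(2)[OF m(1)[OF c]] by (auto simp: adjacent_def)
  qed
  then have "matching (cells p q) m" using m(1,2) by (simp add: matching_def)
  moreover have "D \<in> (\<lambda>c. domino_of c (m c)) ` cells p q" if D: "D \<in> T" for D
  proof -
    obtain a b where ab: "a \<in> cells p q" "adjacent a b" "D = domino_of a b"
      using dom[OF D] unfolding domino_iff by blast
    then have "center a \<in> D" using center_mem_domino_of by simp
    then have "D = domino_of a (m a)" using uniq[OF ab(1)] D m(3) mem(1) ab(1) by metis
    then show ?thesis using ab(1) by (rule image_eqI)
  qed
  then have "T = (\<lambda>c. domino_of c (m c)) ` cells p q" using m(3) by (intro subset_antisym subsetI) auto
  ultimately show thesis by (rule that)
qed

lemma matching_imp_domino_tiling:
  assumes "p > 0" "q > 0" and m: "matching (cells p q) m"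
  shows "domino_tiling p q ((\<lambda>c. domino_of c (m c)) ` cells p q)"
  unfolding domino_tiling_iff[OF assms(1,2)]
proof (intro conjI ballI)
  have mc: "m c \<in> cells p q" "adjacent c (m c)" "m (m c) = c" if "c \<in> cells p q" for c
    using that m by (auto simp: matching_def)
  fix D assume "D \<in> (\<lambda>c. domino_of c (m c)) ` cells p q"
  then show "domino p q D" unfolding domino_iff using mc by blast
next
  have mc: "m c \<in> cells p q" "adjacent c (m c)" "m (m c) = c" if "c \<in> cells p q" for c
    using that m by (auto simp: matching_def)
  fix e assume e: "e \<in> cells p q"
  show "\<exists>!D. D \<in> (\<lambda>c. domino_of c (m c)) ` cells p q \<and> center e \<in> D"
  proof (rule ex1I)
    show "domino_of e (m e) \<in> (\<lambda>c. domino_of c (m c)) ` cells p q \<and> center e \<in> domino_of e (m e)"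
      using e center_mem_domino_of mc(2) by blast
  next
    fix D assume "D \<in> (\<lambda>c. domino_of c (m c)) ` cells p q \<and> center e \<in> D"
    then obtain c where c: "c \<in> cells p q" "D = domino_of c (m c)" "center e \<in> D" by blast
    then have "e = c \<or> e = m c" using center_mem_domino_of mc(2) by simp
    then show "D = domino_of e (m e)" using c mc(3) domino_of_sym by metis
  qed
qed

section \<open>Bisection of dominoes in terms of cells\<close>

lemma cbox_Pair_inject:
  fixes a b c d :: real
  assumes "a < c" "b < d"
  shows "cbox (a, b) (c, d) = cbox (a', b') (c', d') \<longleftrightarrow> a = a' \<and> b = b' \<and> c = c' \<and> d = d'"
  using assms by (auto simp: cbox_Pair_eq times_eq_iff Icc_eq_Icc)

text \<open>The ends of the side shared by the two cells are the midpoints of the long sides of the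
  domino.\<close>

lemma shorter_axis_domino_of:
  assumes "adjacent c d" "sep c d = {v, w}"
  shows "shorter_axis (domino_of c d) S \<longleftrightarrow> S = closed_segment (pt v) (pt w)"
proof -
  have horizontal: "shorter_axis (cbox (a, b) (a + 2, b + 1)) S \<longleftrightarrow>
      S = closed_segment (a + 1, b) (a + 1, b + 1)" for a b
    by (auto simp: shorter_axis_def cbox_Pair_inject)
  have vertical: "shorter_axis (cbox (a, b) (a + 1, b + 2)) S \<longleftrightarrow>
      S = closed_segment (a, b + 1) (a + 1, b + 1)" for a b
    by (auto simp: shorter_axis_def cbox_Pair_inject)
  have seg: "closed_segment (pt v) (pt w) = closed_segment (pt v') (pt w')" if "sep c d = {v', w'}" for v' w'
    using that assms(2) by (auto simp: doubleton_eq_iff closed_segment_commute)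
  show ?thesis
    using assms(1)
  proof (cases rule: adjacent_cases)
    case (1 x y)
    have dom: "domino_of c d = cbox (real_of_int x, real_of_int y) (real_of_int x + 2, real_of_int y + 1)"
      by (simp add: 1 domino_of_def pt_def add.commute)
    have axis: "closed_segment (pt v) (pt w) = closed_segment (pt (x + 1, y)) (pt (x + 1, y + 1))"
      by (rule seg) (simp add: 1 sep_def)
    show ?thesis unfolding dom horizontal axis unfolding pt_def by simp
  next
    case (2 x y)
    have dom: "domino_of c d = cbox (real_of_int x, real_of_int y) (real_of_int x + 2, real_of_int y + 1)"
      by (simp add: 2 domino_of_def pt_def add.commute)
    have axis: "closed_segment (pt v) (pt w) = closed_segment (pt (x + 1, y)) (pt (x + 1, y + 1))"
      by (rule seg) (simp add: 2 sep_def)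
    show ?thesis unfolding dom horizontal axis unfolding pt_def by simp
  next
    case (3 x y)
    have dom: "domino_of c d = cbox (real_of_int x, real_of_int y) (real_of_int x + 1, real_of_int y + 2)"
      by (simp add: 3 domino_of_def pt_def add.commute)
    have axis: "closed_segment (pt v) (pt w) = closed_segment (pt (x, y + 1)) (pt (x + 1, y + 1))"
      by (rule seg) (simp add: 3 sep_def)
    show ?thesis unfolding dom vertical axis unfolding pt_def by simp
  next
    case (4 x y)
    have dom: "domino_of c d = cbox (real_of_int x, real_of_int y) (real_of_int x + 1, real_of_int y + 2)"
      by (simp add: 4 domino_of_def pt_def add.commute)
    have axis: "closed_segment (pt v) (pt w) = closed_segment (pt (x, y + 1)) (pt (x + 1, y + 1))"
      by (rule seg) (simp add: 4 sep_def)
    show ?thesis unfolding dom vertical axis unfolding pt_def by simp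
  qed
qed

lemma bisects_domino_of:
  assumes "adjacent c d"
  shows "bisects vs (domino_of c d) \<longleftrightarrow> (\<exists>(u, v)\<in>set (vwalk_arcs vs). sep c d = {u, v})"
proof -
  have pt_inj: "pt u = pt v \<longleftrightarrow> u = v" for u v by (auto simp: pt_def prod_eq_iff)
  obtain v w where vw: "sep c d = {v, w}" by (simp add: sep_def)
  have "closed_segment (pt u) (pt u') = closed_segment (pt v) (pt w) \<longleftrightarrow> sep c d = {u, u'}" for u u'
    by (auto simp: vw doubleton_eq_iff pt_inj)
  then show ?thesis
    unfolding bisects_def shorter_axis_domino_of[OF assms vw] by simp
qed

section \<open>The correspondence\<close>

abbreviation tiling_of :: "nat \<Rightarrow> nat \<Rightarrow> (int \<times> int \<Rightarrow> int \<times> int) \<Rightarrow> (real \<times> real) set set" where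
  "tiling_of p q m \<equiv> (\<lambda>c. domino_of c (m c)) ` cells p q"

text \<open>The ends of the axis of a domino lie in the grid, so by
  \<open>hamiltonian_path_arcs\<close> the axis is an arc of the path exactly when a step traverses
  it.\<close>

lemma avoids_tiling_iff:
  assumes m: "matching (cells p q) m"
    and vs: "hamiltonian_path (DGG p q) vs" "follows \<sigma> vs"
  shows "(\<forall>D\<in>tiling_of p q m. \<not> bisects vs D) \<longleftrightarrow> (\<forall>c\<in>cells p q. passable \<sigma> c (m c))"
proof -
  have "bisects vs (domino_of c (m c)) \<longleftrightarrow> \<not> passable \<sigma> c (m c)" if c: "c \<in> cells p q" for c
  proof -
    have mc: "m c \<in> cells p q" "adjacent c (m c)" using m c by (auto simp: matching_def)
    have bis: "bisects vs (domino_of c (m c)) \<longleftrightarrow>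
        (\<exists>u. u \<in> grid p q \<and> step \<sigma> u \<in> grid p q \<and> sep c (m c) = {u, step \<sigma> u})"
      (is "_ \<longleftrightarrow> ?r")
    proof
      assume "bisects vs (domino_of c (m c))"
      then obtain u v where "(u, v) \<in> set (vwalk_arcs vs)" "sep c (m c) = {u, v}"
        unfolding bisects_domino_of[OF mc(2)] by blast
      then show ?r
        unfolding hamiltonian_path_arcs[OF vs] mem_Collect_eq prod.inject by metis
    next
      assume ?r
      then obtain u where ug: "u \<in> grid p q \<and> step \<sigma> u \<in> grid p q" "sep c (m c) = {u, step \<sigma> u}"
        by (elim exE conjE) (rule that; simp only: simp_thms)
      then have u: "(u, step \<sigma> u) \<in> set (vwalk_arcs vs)" "sep c (m c) = {u, step \<sigma> u}"
        unfolding hamiltonian_path_arcs[OF vs] by (simp_all only: mem_Collect_eq, metis)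
      show "bisects vs (domino_of c (m c))"
        unfolding bisects_domino_of[OF mc(2)] using u by (intro bexI[OF _ u(1)]) simp
    qed
    have "sep c (m c) \<subseteq> grid p q"
      using c mc(1) by (auto simp: sep_def cells_def)
    then show ?thesis
      unfolding bis using passable_imp_sep_neq[OF mc(2)] sep_eq_step[OF mc(2)]
      by (metis insert_subset)
  qed
  then show ?thesis by simp
qed

lemma black_out_cell: "black (out_cell u)"
  by (auto simp: step_defs split: prod.splits)

lemma unique_path_avoiding_tiling:
  assumes "p > 0" "q > 0" "domino_tiling p q T"
  shows "\<exists>!vs. hamiltonian_path (DGG p q) vs \<and> (\<forall>D\<in>T. \<not> bisects vs D)"
proof -
  obtain m where m: "matching (cells p q) m" and T: "T = tiling_of p q m"
    using assms by (rule domino_tiling_imp_matching)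
  \<comment> \<open>Steps run parallel to the long sides of the domino at each black cell.\<close>
  define \<tau> where "\<tau> c \<longleftrightarrow> snd c = snd (m c)" for c
  have pass: "passable (extend p q \<tau>) c (m c)" if c: "c \<in> cells p q" for c
  proof -
    have "m c \<in> cells p q" "m (m c) = c" using m c by (auto simp: matching_def)
    then show ?thesis using c by (auto simp: passable_def extend_def \<tau>_def)
  qed
  have no_closed: False if "S \<noteq> {}" "S \<subseteq> grid p q" "step (extend p q \<tau>) ` S \<subseteq> S" for S
    using no_closed_sets(1)[OF m _ that] pass by metis
  obtain vs where vs: "hamiltonian_path (DGG p q) vs" "follows (extend p q \<tau>) vs"
    by (rule hamiltonian_path_exists[OF assms(1,2) matching_imp_odd[OF assms(1,2) m], where \<tau> = \<tau>])
       (erule (2) no_closed, blast)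
  have avoids: "\<forall>D\<in>T. \<not> bisects vs D"
    using avoids_tiling_iff[OF m vs] pass T by simp
  have "ws = vs" if ws: "hamiltonian_path (DGG p q) ws" "\<forall>D\<in>T. \<not> bisects ws D" for ws
  proof -
    obtain \<tau>' where \<tau>': "follows (extend p q \<tau>') ws"
      using hamiltonian_path_follows[OF ws(1)] by blast
    have pass': "\<forall>c\<in>cells p q. passable (extend p q \<tau>') c (m c)"
      using avoids_tiling_iff[OF m ws(1) \<tau>'] ws(2) T by simp
    \<comment> \<open>Passability determines the choice at black cells, and \<open>step\<close>
      consults it only there.\<close>
    have "extend p q \<tau>' c = extend p q \<tau> c" if "black c" for c
    proof (cases "c \<in> cells p q")
      case True
      with pass' have "passable (extend p q \<tau>') c (m c)" by blast
      then show ?thesis using that True by (simp add: passable_def extend_def \<tau>_def)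
    qed (simp add: extend_def)
    then have "step (extend p q \<tau>') u = step (extend p q \<tau>) u" for u
      by (simp add: step_def black_out_cell)
    then have "follows (extend p q \<tau>) ws" using \<tau>' by (simp add: follows_def)
    then show "ws = vs" using hamiltonian_path_unique ws(1) vs by blast
  qed
  then show ?thesis using vs(1) avoids by blast
qed

text \<open>Existence comes from \<open>matching_exists\<close>, as a path excludes closed vertex
  sets. For uniqueness, the descent excludes closed cell sets of the competing tiling.\<close>

lemma unique_tiling_avoided_by_path:
  assumes "p > 0" "q > 0" and vs: "hamiltonian_path (DGG p q) vs"
  shows "\<exists>!T. domino_tiling p q T \<and> (\<forall>D\<in>T. \<not> bisects vs D)"
proof -
  obtain \<tau> where \<tau>: "follows (extend p q \<tau>) vs"
    using hamiltonian_path_follows[OF vs] by blast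
  obtain m where m: "matching (cells p q) m"
    and pass: "\<And>c. c \<in> cells p q \<Longrightarrow> passable (extend p q \<tau>) c (m c)"
    by (rule matching_exists[OF hamiltonian_path_imp_odd[OF assms], where \<tau> = \<tau>])
       (erule (2) hamiltonian_path_no_closed_set[OF vs \<tau>], blast)
  have "T = tiling_of p q m" if T: "domino_tiling p q T" "\<forall>D\<in>T. \<not> bisects vs D" for T
  proof -
    obtain m' where m': "matching (cells p q) m'" and T_eq: "T = tiling_of p q m'"
      using assms(1,2) T(1) by (rule domino_tiling_imp_matching)
    have pass': "\<And>c. c \<in> cells p q \<Longrightarrow> passable (extend p q \<tau>) c (m' c)"
      using avoids_tiling_iff[OF m' vs \<tau>] T(2) T_eq by simp
    have no_closed: False if "R \<noteq> {}" "R \<subseteq> cells p q" "across m' ` R \<subseteq> R" for R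
      using no_closed_sets(2)[OF m' _ that] pass' by metis
    have "\<forall>c\<in>cells p q. m c = m' c"
      by (rule matching_unique[OF m _ m'], erule pass, erule pass', erule (2) no_closed)
    then show ?thesis unfolding T_eq by simp
  qed
  moreover have "domino_tiling p q (tiling_of p q m)"
    using assms(1,2) m by (rule matching_imp_domino_tiling)
  moreover have "\<forall>D\<in>tiling_of p q m. \<not> bisects vs D"
    using avoids_tiling_iff[OF m vs \<tau>] pass by simp
  ultimately show ?thesis by (intro ex1I[of _ "tiling_of p q m"]) blast+
qed

theorem theorem1:
  fixes p q :: nat
  assumes "p > 0" and "q > 0"
  shows "\<exists>\<Phi>. bij_betw \<Phi> {T. domino_tiling p q T} {vs. hamiltonian_path (DGG p q) vs} \<and>
           (\<forall>T. domino_tiling p q T \<longrightarrow>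
              {vs. hamiltonian_path (DGG p q) vs \<and> (\<forall>D\<in>T. \<not> bisects vs D)} = {\<Phi> T})"
proof -
  \<comment> \<open>Each tiling avoids one path and each path one tiling, so this relation is the
    graph of a bijection.\<close>
  define avoids where
    "avoids T vs \<longleftrightarrow> hamiltonian_path (DGG p q) vs \<and> (\<forall>D\<in>T. \<not> bisects vs D)" for T vs
  define \<Phi> where "\<Phi> T = (THE vs. avoids T vs)" for T
  have path: "avoids T vs \<longleftrightarrow> vs = \<Phi> T" if "domino_tiling p q T" for T vs
  proof -
    have ex1: "\<exists>!vs. avoids T vs"
      using unique_path_avoiding_tiling[OF assms that] by (simp add: avoids_def)
    then show ?thesis unfolding \<Phi>_def using theI'[OF ex1] by blast
  qed
  have tiling: "\<exists>!T. domino_tiling p q T \<and> vs = \<Phi> T" if "hamiltonian_path (DGG p q) vs" for vs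
    using unique_tiling_avoided_by_path[OF assms that] that path unfolding avoids_def by metis
  have ham: "hamiltonian_path (DGG p q) (\<Phi> T)" if "domino_tiling p q T" for T
    using path[OF that] unfolding avoids_def by blast
  have "bij_betw \<Phi> {T. domino_tiling p q T} {vs. hamiltonian_path (DGG p q) vs}"
    unfolding bij_betw_def
  proof (rule conjI)
    have "T = U" if "domino_tiling p q T" "domino_tiling p q U" "\<Phi> T = \<Phi> U" for T U
      using that tiling[OF ham] by metis
    then show "inj_on \<Phi> {T. domino_tiling p q T}" by (simp add: inj_on_def)
    show "\<Phi> ` {T. domino_tiling p q T} = {vs. hamiltonian_path (DGG p q) vs}"
      using ham tiling by blast
  qed
  moreover have "{vs. hamiltonian_path (DGG p q) vs \<and> (\<forall>D\<in>T. \<not> bisects vs D)} = {\<Phi> T}"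
    if "domino_tiling p q T" for T
    using path[OF that] unfolding avoids_def by blast
  ultimately show ?thesis by blast
qed

end
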